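(* Let $f\colon B\to M$ be a smooth map between smooth manifolds. Let $A$ be a Lie algebroid over $M$, and assume that $f^!A$ is smooth. Then $$\mathcal{F}_{f^!A}=f^{-1}(\mathcal{F}_A).$$
   Context: Let $A\to M$ be a Lie algebroid with anchor $\rho\colon A\to TM$, and $f\colon B\to M$ smooth. Subscript $c$ means "compactly supported". **Pullback Lie algebroid.** $f^!A:=f^*A\times_{TM}TB=\{(a,v)\in f^*A\oplus TB:\rho(a)=f_*v\}$, a subset of the vector bundle $f^*A\oplus TB$ over $B$, where $f^*A$ is the vector bundle pullback. One says "$f^!A$ is smooth" if the fibers of $f^!A\to B$ have constant rank (equivalently, $f^!A$ is a vector subbundle of $f^*A\oplus TB$). In that case $f^!A$ is a Lie algebroid over $B$: the anchor is the projection $(a,v)\mapsto v$ to $TB$. Sections are of the form $(\sum_i h_i a_i, X)$ (finite sum, $a_i$ standing for $a_i\circ f$) with $h_i\in C^\infty(B)$, $a_i\in\Gamma(A)$, $X\in\mathfrak{X}(B)$ and $f_*X=\sum_i h_i\,\rho(a_i)$ as sections of $f^*TM$. The bracket is $$\Big[\big(\textstyle\sum_i h_ia_i,X\big),\big(\sum_j h'_ja'_j,X'\big)\Big]=\Big(\sum_{i,j}h_ih'_j[a_i,a'_j]+\sum_jX(h'_j)a'_j-\sum_iX'(h_i)a_i,\ [X,X']\Big).$$ **Singular foliation of a Lie algebroid.** For a Lie algebroid $A$ over $M$ with anchor $\rho$, $\mathcal{F}_A:=\rho(\Gamma_c(A))\subset\mathfrak{X}_c(M)$. (A singular foliation on $M$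 is a locally finitely generated $C^\infty(M)$-submodule of $\mathfrak{X}_c(M)$ that is closed under the Lie bracket.) **Pullback of a submodule of vector fields.** For $\mathcal{F}\subset\mathfrak{X}_c(M)$, $$f^{-1}\mathcal{F}:=\Big\{X\in\mathfrak{X}_c(B): f_*X=\sum_i h_i\,(Y_i\circ f)\text{ (finite sum) for some }h_i\in C^\infty_c(B),\ Y_i\in\mathcal{F}\Big\},$$ where $f_*X$ is regarded as a section of $f^*TM$. *)

theory Defs
  imports "HOL-Analysis.Analysis" "HOL-Library.Function_Algebras"
begin

text \<open>
  Model spaces for charts and fibres. In contrast to class \<open>euclidean_space\<close>, dimension 0 is
  admitted, so that 0-dimensional manifolds and bundles of rank 0 are covered.
\<close>

class fin_dim_inner = real_inner +
  assumes finite_spanning: "\<exists>S. finite S \<and> (\<forall>x. \<exists>u. x = (\<Sum>b\<in>S. u b *\<^sub>R b))"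

instance euclidean_space \<subseteq> fin_dim_inner
  by standard (metis finite_Basis euclidean_representation)

text \<open>Pointwise vector space structure on functions, used for tangent vectors and for sections.\<close>

instantiation "fun" :: (type, real_vector) real_vector
begin

definition scaleR_fun :: "real \<Rightarrow> ('a \<Rightarrow> 'b) \<Rightarrow> 'a \<Rightarrow> 'b"
  where "scaleR_fun c f = (\<lambda>x. c *\<^sub>R f x)"

instance
  by standard (auto simp: scaleR_fun_def fun_eq_iff scaleR_add_right scaleR_add_left)

end


section \<open>Smooth manifolds and smooth maps\<close>

text \<open>\<open>S\<close> is meant to be open, and the domain finite-dimensional: then continuity of all directional
  derivatives is continuity of the derivative.\<close>

fun Ck_on :: "nat \<Rightarrow> 'a::real_normed_vector set \<Rightarrow> ('a \<Rightarrow> 'b::real_normed_vector) \<Rightarrow> bool" where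
  "Ck_on 0 S f \<longleftrightarrow> continuous_on S f"
| "Ck_on (Suc k) S f \<longleftrightarrow>
     (\<forall>x\<in>S. f differentiable (at x)) \<and> (\<forall>v. Ck_on k S (\<lambda>x. frechet_derivative f (at x) v))"

definition smooth_on :: "'a::real_normed_vector set \<Rightarrow> ('a \<Rightarrow> 'b::real_normed_vector) \<Rightarrow> bool"
  where "smooth_on S f \<longleftrightarrow> (\<forall>k. Ck_on k S f)"

text \<open>A chart is a pair of its domain and its coordinate map; the values of the coordinate map
  outside the domain are irrelevant.\<close>

type_synonym ('m, 'e) chart = "'m set \<times> ('m \<Rightarrow> 'e)"
type_synonym ('m, 'e) atlas = "('m, 'e) chart set"

text \<open>The manifold is the whole type \<open>'m\<close>, with the smooth structure given by an atlas (not
  necessarily maximal).\<close>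

definition smooth_manifold ::
  "('m::{t2_space, second_countable_topology}, 'e::fin_dim_inner) atlas \<Rightarrow> bool"
  where "smooth_manifold M \<longleftrightarrow>
    (\<Union>(U, \<kappa>)\<in>M. U) = UNIV \<and>
    (\<forall>(U, \<kappa>)\<in>M. open U \<and> open (\<kappa> ` U) \<and> homeomorphism U (\<kappa> ` U) \<kappa> (the_inv_into U \<kappa>)) \<and>
    (\<forall>(U, \<kappa>)\<in>M. \<forall>(V, \<mu>)\<in>M. smooth_on (\<kappa> ` (U \<inter> V)) (\<mu> \<circ> the_inv_into U \<kappa>))"

definition smooth_fun_on ::
  "('m, 'e::real_normed_vector) atlas \<Rightarrow> 'm set \<Rightarrow> ('m \<Rightarrow> 'w::real_normed_vector) \<Rightarrow> bool"
  where "smooth_fun_on M W g \<longleftrightarrow>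
    (\<forall>(U, \<kappa>)\<in>M. smooth_on (\<kappa> ` (U \<inter> W)) (g \<circ> the_inv_into U \<kappa>))"

definition Cinf :: "('m, 'e::real_normed_vector) atlas \<Rightarrow> ('m \<Rightarrow> real) set"
  where "Cinf M = {g. smooth_fun_on M UNIV g}"

definition compactly_supported :: "('m::topological_space \<Rightarrow> 'v::zero) \<Rightarrow> bool"
  where "compactly_supported s \<longleftrightarrow> compact (closure {p. s p \<noteq> 0})"

definition Cinf_c :: "('m::topological_space, 'e::real_normed_vector) atlas \<Rightarrow> ('m \<Rightarrow> real) set"
  where "Cinf_c M = {g \<in> Cinf M. compactly_supported g}"

definition smooth_map ::
  "('b::topological_space, 'd::real_normed_vector) atlas \<Rightarrow>
   ('m::topological_space, 'e::real_normed_vector) atlas \<Rightarrow> ('b \<Rightarrow> 'm) \<Rightarrow> bool"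
  where "smooth_map B M f \<longleftrightarrow> continuous_on UNIV f \<and>
    (\<forall>(U, \<kappa>)\<in>B. \<forall>(V, \<mu>)\<in>M. smooth_on (\<kappa> ` (U \<inter> f -` V)) (\<mu> \<circ> f \<circ> the_inv_into U \<kappa>))"


section \<open>Vector bundles\<close>

text \<open>
  The fibres are subspaces of a real vector space \<open>'v\<close>. The latter only provides the algebraic
  operations; the smooth structure is given by local trivialisations: an element \<open>(U, \<phi>)\<close> of
  \<open>trivs E\<close> consists of an open set \<open>U\<close> and, for \<open>p \<in> U\<close>, the coordinate map \<open>\<phi> p\<close> of the fibre
  over \<open>p\<close>, with values in \<open>'r\<close>.
\<close>

record ('m, 'v, 'r) vbundle =
  fibre :: "'m \<Rightarrow> 'v set"
  trivs :: "('m set \<times> ('m \<Rightarrow> 'v \<Rightarrow> 'r)) set"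

definition fibre_linear :: "'v::real_vector set \<Rightarrow> ('v \<Rightarrow> 'w::real_vector) \<Rightarrow> bool"
  where "fibre_linear S L \<longleftrightarrow>
    (\<forall>u\<in>S. \<forall>v\<in>S. L (u + v) = L u + L v) \<and> (\<forall>c. \<forall>v\<in>S. L (c *\<^sub>R v) = c *\<^sub>R L v)"

definition vector_bundle ::
  "('m::topological_space, 'e::real_normed_vector) atlas \<Rightarrow>
   ('m, 'v::real_vector, 'r::fin_dim_inner, 'x) vbundle_scheme \<Rightarrow> bool"
  where "vector_bundle M E \<longleftrightarrow>
    (\<forall>p. subspace (fibre E p)) \<and>
    (\<Union>(U, \<phi>)\<in>trivs E. U) = UNIV \<and>
    (\<forall>(U, \<phi>)\<in>trivs E. open U \<and>
       (\<forall>p\<in>U. fibre_linear (fibre E p) (\<phi> p) \<and> bij_betw (\<phi> p) (fibre E p) UNIV)) \<and>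
    (\<forall>(U, \<phi>)\<in>trivs E. \<forall>(V, \<psi>)\<in>trivs E. \<forall>x.
       smooth_fun_on M (U \<inter> V) (\<lambda>p. \<psi> p (the_inv_into (fibre E p) (\<phi> p) x)))"

definition sections ::
  "('m, 'e::real_normed_vector) atlas \<Rightarrow> ('m, 'v, 'r::real_normed_vector, 'x) vbundle_scheme \<Rightarrow>
   ('m \<Rightarrow> 'v) set"
  where "sections M E =
    {s. (\<forall>p. s p \<in> fibre E p) \<and> (\<forall>(U, \<phi>)\<in>trivs E. smooth_fun_on M U (\<lambda>p. \<phi> p (s p)))}"

definition sections_c ::
  "('m::topological_space, 'e::real_normed_vector) atlas \<Rightarrow>
   ('m, 'v::zero, 'r::real_normed_vector, 'x) vbundle_scheme \<Rightarrow> ('m \<Rightarrow> 'v) set"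
  where "sections_c M E = {s \<in> sections M E. compactly_supported s}"

definition pullback_bundle ::
  "('b \<Rightarrow> 'm) \<Rightarrow> ('m, 'v, 'r, 'x) vbundle_scheme \<Rightarrow> ('b, 'v, 'r) vbundle"
  where "pullback_bundle f E =
    \<lparr>fibre = (\<lambda>p. fibre E (f p)),
     trivs = {(f -` U, \<lambda>p. \<phi> (f p)) | U \<phi>. (U, \<phi>) \<in> trivs E}\<rparr>"

definition whitney_sum ::
  "('m, 'v, 'r, 'x) vbundle_scheme \<Rightarrow> ('m, 'w, 's, 'y) vbundle_scheme \<Rightarrow>
   ('m, 'v \<times> 'w, 'r \<times> 's) vbundle"
  where "whitney_sum E F =
    \<lparr>fibre = (\<lambda>p. fibre E p \<times> fibre F p),
     trivs = {(U \<inter> V, \<lambda>p. map_prod (\<phi> p) (\<psi> p)) | U \<phi> V \<psi>.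
               (U, \<phi>) \<in> trivs E \<and> (V, \<psi>) \<in> trivs F}\<rparr>"


section \<open>Tangent bundle and vector fields\<close>

type_synonym 'm tvec = "('m \<Rightarrow> real) \<Rightarrow> real"

text \<open>Tangent vectors are derivations of the algebra of smooth functions. The value 0 on functions
  that are not smooth is a convention which makes them equal if they agree on smooth functions.\<close>

definition tangent_space :: "('m, 'e::real_normed_vector) atlas \<Rightarrow> 'm \<Rightarrow> 'm tvec set"
  where "tangent_space M p = {D.
    (\<forall>g\<in>Cinf M. \<forall>h\<in>Cinf M. D (\<lambda>q. g q + h q) = D g + D h) \<and>
    (\<forall>c. \<forall>g\<in>Cinf M. D (\<lambda>q. c * g q) = c * D g) \<and>
    (\<forall>g\<in>Cinf M. \<forall>h\<in>Cinf M. D (\<lambda>q. g q * h q) = g p * D h + h p * D g) \<and>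
    (\<forall>g. g \<notin> Cinf M \<longrightarrow> D g = 0)}"

text \<open>The tangent vector at \<open>p\<close> with coordinates \<open>w\<close> in a chart.\<close>

definition chart_vec ::
  "('m, 'e::real_normed_vector) atlas \<Rightarrow> ('m, 'e) chart \<Rightarrow> 'm \<Rightarrow> 'e \<Rightarrow> 'm tvec"
  where "chart_vec M = (\<lambda>(U, \<kappa>) p w g.
    if g \<in> Cinf M then frechet_derivative (g \<circ> the_inv_into U \<kappa>) (at (\<kappa> p)) w else 0)"

definition tangent_bundle ::
  "('m, 'e::real_normed_vector) atlas \<Rightarrow> ('m, 'm tvec, 'e) vbundle"
  where "tangent_bundle M =
    \<lparr>fibre = tangent_space M,
     trivs = {(U, \<lambda>p. the_inv (chart_vec M (U, \<kappa>) p)) | U \<kappa>. (U, \<kappa>) \<in> M}\<rparr>"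

abbreviation vector_fields :: "('m, 'e::real_normed_vector) atlas \<Rightarrow> ('m \<Rightarrow> 'm tvec) set"
  where "vector_fields M \<equiv> sections M (tangent_bundle M)"

abbreviation vector_fields_c ::
  "('m::topological_space, 'e::real_normed_vector) atlas \<Rightarrow> ('m \<Rightarrow> 'm tvec) set"
  where "vector_fields_c M \<equiv> sections_c M (tangent_bundle M)"

definition lie_bracket ::
  "('m, 'e::real_normed_vector) atlas \<Rightarrow> ('m \<Rightarrow> 'm tvec) \<Rightarrow> ('m \<Rightarrow> 'm tvec) \<Rightarrow> 'm \<Rightarrow> 'm tvec"
  where "lie_bracket M X Y = (\<lambda>p g.
    if g \<in> Cinf M then X p (\<lambda>q. Y q g) - Y p (\<lambda>q. X q g) else 0)"

definition pushforward ::
  "('m, 'e::real_normed_vector) atlas \<Rightarrow> ('b \<Rightarrow> 'm) \<Rightarrow> 'b tvec \<Rightarrow> 'm tvec"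
  where "pushforward M f D = (\<lambda>g. if g \<in> Cinf M then D (g \<circ> f) else 0)"


section \<open>Lie algebroids\<close>

record ('m, 'v, 'r) algebroid = "('m, 'v, 'r) vbundle" +
  anchor :: "'m \<Rightarrow> 'v \<Rightarrow> 'm tvec"
  bracket :: "('m \<Rightarrow> 'v) \<Rightarrow> ('m \<Rightarrow> 'v) \<Rightarrow> 'm \<Rightarrow> 'v"

definition bundle_morphism ::
  "('m, 'e::real_normed_vector) atlas \<Rightarrow>
   ('m, 'v::real_vector, 'r::real_normed_vector, 'x) vbundle_scheme \<Rightarrow>
   ('m, 'w::real_vector, 's::real_normed_vector, 'y) vbundle_scheme \<Rightarrow>
   ('m \<Rightarrow> 'v \<Rightarrow> 'w) \<Rightarrow> bool"
  where "bundle_morphism M E F L \<longleftrightarrow>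
    (\<forall>p. L p ` fibre E p \<subseteq> fibre F p \<and> fibre_linear (fibre E p) (L p)) \<and>
    (\<forall>(U, \<phi>)\<in>trivs E. \<forall>(V, \<psi>)\<in>trivs F. \<forall>x.
       smooth_fun_on M (U \<inter> V) (\<lambda>p. \<psi> p (L p (the_inv_into (fibre E p) (\<phi> p) x))))"

text \<open>That the anchor is a homomorphism of Lie algebras follows from the Jacobi identity and the
  Leibniz rule.\<close>

definition lie_algebroid ::
  "('m::{t2_space, second_countable_topology}, 'e::fin_dim_inner) atlas \<Rightarrow>
   ('m, 'v::real_vector, 'r::fin_dim_inner) algebroid \<Rightarrow> bool"
  where "lie_algebroid M A \<longleftrightarrow>
    vector_bundle M A \<and>
    bundle_morphism M A (tangent_bundle M) (anchor A) \<and>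
    (\<forall>a\<in>sections M A. \<forall>b\<in>sections M A.
       bracket A a b \<in> sections M A \<and>
       bracket A a b = - bracket A b a \<and>
       (\<forall>t. bracket A (t *\<^sub>R a) b = t *\<^sub>R bracket A a b) \<and>
       (\<forall>g\<in>Cinf M. bracket A a (\<lambda>p. g p *\<^sub>R b p) =
          (\<lambda>p. g p *\<^sub>R bracket A a b p + anchor A p (a p) g *\<^sub>R b p))) \<and>
    (\<forall>a\<in>sections M A. \<forall>b\<in>sections M A. \<forall>c\<in>sections M A.
       bracket A (a + b) c = bracket A a c + bracket A b c \<and>
       bracket A a (bracket A b c) + bracket A b (bracket A c a) + bracket A c (bracket A a b) = 0)"

definition foliation ::
  "('m::topological_space, 'e::real_normed_vector) atlas \<Rightarrow>
   ('m, 'v::real_vector, 'r::real_normed_vector) algebroid \<Rightarrow> ('m \<Rightarrow> 'm tvec) set"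
  where "foliation M A = {(\<lambda>p. anchor A p (a p)) | a. a \<in> sections_c M A}"

definition pullback_vector_fields ::
  "('b::topological_space, 'd::real_normed_vector) atlas \<Rightarrow> ('m, 'e::real_normed_vector) atlas \<Rightarrow>
   ('b \<Rightarrow> 'm) \<Rightarrow> ('m \<Rightarrow> 'm tvec) set \<Rightarrow> ('b \<Rightarrow> 'b tvec) set"
  where "pullback_vector_fields B M f \<F> = {X \<in> vector_fields_c B.
    \<exists>(n::nat) h Y. (\<forall>i<n. h i \<in> Cinf_c B \<and> Y i \<in> \<F>) \<and>
      (\<forall>p. pushforward M f (X p) = (\<Sum>i<n. h i p *\<^sub>R Y i (f p)))}"


section \<open>Pullback Lie algebroids\<close>

definition pullback_fibre ::
  "('b, 'd::real_normed_vector) atlas \<Rightarrow> ('m, 'e::real_normed_vector) atlas \<Rightarrow> ('b \<Rightarrow> 'm) \<Rightarrow>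
   ('m, 'v::real_vector, 'r) algebroid \<Rightarrow> 'b \<Rightarrow> ('v \<times> 'b tvec) set"
  where "pullback_fibre B M f A p =
    {(a, v) \<in> fibre (whitney_sum (pullback_bundle f A) (tangent_bundle B)) p.
       anchor A (f p) a = pushforward M f v}"

definition pullback_smooth ::
  "('b, 'd::real_normed_vector) atlas \<Rightarrow> ('m, 'e::real_normed_vector) atlas \<Rightarrow> ('b \<Rightarrow> 'm) \<Rightarrow>
   ('m, 'v::real_vector, 'r) algebroid \<Rightarrow> bool"
  where "pullback_smooth B M f A \<longleftrightarrow> (\<exists>k. \<forall>p. dim (pullback_fibre B M f A p) = k)"

text \<open>\<open>s\<close> is of the form \<open>(\<Sum>i<n. h\<^sub>i a\<^sub>i, X)\<close>, where \<open>X = snd \<circ> s\<close>.\<close>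

definition pullback_section ::
  "('b, 'd::real_normed_vector) atlas \<Rightarrow> ('m, 'e::real_normed_vector) atlas \<Rightarrow> ('b \<Rightarrow> 'm) \<Rightarrow>
   ('m, 'v::real_vector, 'r::real_normed_vector) algebroid \<Rightarrow>
   nat \<Rightarrow> (nat \<Rightarrow> 'b \<Rightarrow> real) \<Rightarrow> (nat \<Rightarrow> 'm \<Rightarrow> 'v) \<Rightarrow> ('b \<Rightarrow> 'v \<times> 'b tvec) \<Rightarrow> bool"
  where "pullback_section B M f A n h a s \<longleftrightarrow>
    (\<forall>i<n. h i \<in> Cinf B \<and> a i \<in> sections M A) \<and>
    (\<forall>p. fst (s p) = (\<Sum>i<n. h i p *\<^sub>R a i (f p)))"

text \<open>The value does not depend on the chosen representations of the two sections.\<close>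

definition pullback_bracket ::
  "('b, 'd::real_normed_vector) atlas \<Rightarrow> ('m, 'e::real_normed_vector) atlas \<Rightarrow> ('b \<Rightarrow> 'm) \<Rightarrow>
   ('m, 'v::real_vector, 'r::real_normed_vector) algebroid \<Rightarrow>
   ('b \<Rightarrow> 'v \<times> 'b tvec) \<Rightarrow> ('b \<Rightarrow> 'v \<times> 'b tvec) \<Rightarrow> 'b \<Rightarrow> 'v \<times> 'b tvec"
  where "pullback_bracket B M f A s s' = (THE t. \<exists>n h a n' h' a'.
    pullback_section B M f A n h a s \<and> pullback_section B M f A n' h' a' s' \<and>
    t = (\<lambda>p.
      ((\<Sum>i<n. \<Sum>j<n'. (h i p * h' j p) *\<^sub>R bracket A (a i) (a' j) (f p))
         + (\<Sum>j<n'. snd (s p) (h' j) *\<^sub>R a' j (f p))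
         - (\<Sum>i<n. snd (s' p) (h i) *\<^sub>R a i (f p)),
       lie_bracket B (snd \<circ> s) (snd \<circ> s') p)))"

text \<open>
  As a subbundle, the pullback carries the smooth structure induced from the ambient Whitney sum: its
  smooth sections are the smooth sections of the sum which take values in the subbundle. Accordingly
  the field \<open>trivs\<close> holds the trivialisations of the sum; they are injective but in general not
  surjective on the fibres of the subbundle.
\<close>

definition pullback_algebroid ::
  "('b, 'd::real_normed_vector) atlas \<Rightarrow> ('m, 'e::real_normed_vector) atlas \<Rightarrow> ('b \<Rightarrow> 'm) \<Rightarrow>
   ('m, 'v::real_vector, 'r::real_normed_vector) algebroid \<Rightarrow>
   ('b, 'v \<times> 'b tvec, 'r \<times> 'd) algebroid"
  where "pullback_algebroid B M f A =
    \<lparr>fibre = pullback_fibre B M f A,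
     trivs = trivs (whitney_sum (pullback_bundle f A) (tangent_bundle B)),
     anchor = (\<lambda>p. snd),
     bracket = pullback_bracket B M f A\<rparr>"

end

theory Submission
  imports Defs
begin

text \<open>
  The fibrewise condition defining \<open>f\<^sup>!A\<close> says that the anchor of the first component of a section
  \<open>(a, X)\<close> is \<open>f\<^sub>*X\<close>. So everything reduces to the fact that compactly supported sections of \<open>f\<^sup>*A\<close>
  are finite sums \<open>\<Sum> h\<^sub>i (c\<^sub>i \<circ> f)\<close> with \<open>h\<^sub>i\<close> and \<open>c\<^sub>i\<close> compactly supported: near a point, use a local frame
  of \<open>A\<close> around its image, cut off by a bump function on \<open>M\<close>, and cut off the coefficients by a bump
  function on \<open>B\<close>; then patch over the compact support. Conversely, \<open>f\<^sub>*X = \<Sum> h\<^sub>i (\<rho>(c\<^sub>i) \<circ> f)\<close> is the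
  anchor of the compactly supported \<open>\<Sum> h\<^sub>i (c\<^sub>i \<circ> f)\<close>.
\<close>

section \<open>Calculus of smooth functions\<close>

text \<open>Since \<open>S\<close> is open, \<open>f\<close> and \<open>g\<close> agree on a
  neighbourhood of each point of \<open>S\<close>, so their derivatives there coincide and the
  induction passes to the directional derivatives.\<close>

lemma Ck_on_cong:
  assumes "open S" "Ck_on k S f" "\<And>x. x \<in> S \<Longrightarrow> f x = g x"
  shows "Ck_on k S g"
  using assms(2,3)
proof (induction k arbitrary: f g)
  case 0
  then show ?case by (auto cong: continuous_on_cong)
next
  case (Suc k)
  have D: "(g has_derivative frechet_derivative f (at x)) (at x)" if "x \<in> S" for x
    using Suc.prems \<open>open S\<close> that
    by (auto simp: frechet_derivative_works intro: has_derivative_transform_within_open)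
  then have "frechet_derivative f (at x) = frechet_derivative g (at x)" if "x \<in> S" for x
    using that by (intro frechet_derivative_at)
  with Suc.IH Suc.prems(1) have "Ck_on k S (\<lambda>x. frechet_derivative g (at x) v)" for v
    by (metis (no_types, lifting) Ck_on.simps(2))
  with D show ?case by (auto simp: differentiable_def)
qed

text \<open>Uniqueness of derivatives allows an explicit \<open>f'\<close> to replace the chosen
  \<open>frechet_derivative\<close>. Most closure properties below are proved through this rule,
  with \<open>f'\<close> given by the corresponding differentiation rule.\<close>

lemma Ck_on_SucI:
  assumes "open S" "\<And>x. x \<in> S \<Longrightarrow> (f has_derivative f' x) (at x)"
    and "\<And>v. Ck_on k S (\<lambda>x. f' x v)"
  shows "Ck_on (Suc k) S f"
proof -
  have "f' x = frechet_derivative f (at x)" if "x \<in> S" for x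
    using assms(2)[OF that] by (rule frechet_derivative_at)
  with assms(1,3) have "Ck_on k S (\<lambda>x. frechet_derivative f (at x) v)" for v
    by (auto intro: Ck_on_cong[where f = "\<lambda>x. f' x v"])
  with assms(2) show ?thesis by (auto simp: differentiable_def)
qed

lemma Ck_on_Suc_has_derivative:
  "Ck_on (Suc k) S f \<Longrightarrow> x \<in> S \<Longrightarrow> (f has_derivative frechet_derivative f (at x)) (at x)"
  by (simp add: frechet_derivative_works)

lemma Ck_on_Suc_imp: "Ck_on (Suc k) S f \<Longrightarrow> Ck_on k S f"
proof (induction k arbitrary: f)
  case 0
  then show ?case
    by (auto intro!: differentiable_imp_continuous_on differentiable_at_imp_differentiable_on)
qed auto

lemma Ck_on_subset: "Ck_on k S f \<Longrightarrow> T \<subseteq> S \<Longrightarrow> Ck_on k T f"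
  by (induction k arbitrary: f) (auto intro: continuous_on_subset)

text \<open>Differentiability at a point does not refer to the set, and continuity glues over open
  sets. This underlies every later extension by zero.\<close>

lemma Ck_on_Union:
  "\<forall>S\<in>\<S>. open S \<and> Ck_on k S f \<Longrightarrow> Ck_on k (\<Union>\<S>) f"
  by (induction k arbitrary: f) (auto intro: continuous_on_open_Union)

lemma Ck_on_const: "Ck_on k S (\<lambda>x. c)"
proof (induction k arbitrary: c)
  case (Suc k)
  have "frechet_derivative (\<lambda>x. c) (at x) = (\<lambda>v. 0)" for x :: 'a
    by (rule frechet_derivative_const)
  with Suc show ?case by auto
qed simp

lemma Ck_on_bounded_linear:
  assumes "bounded_linear L" "open S" "Ck_on k S f"
  shows "Ck_on k S (\<lambda>x. L (f x))"
  using assms(3)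
proof (induction k arbitrary: f)
  case 0
  then show ?case using assms by (auto intro: bounded_linear.continuous_on)
next
  case (Suc k)
  show ?case
    using Suc by (intro Ck_on_SucI[where f' = "\<lambda>x v. L (frechet_derivative f (at x) v)"]
        bounded_linear.has_derivative[OF assms(1)] \<open>open S\<close>) (auto simp: frechet_derivative_works)
qed

lemma Ck_on_ident: "open S \<Longrightarrow> Ck_on k S (\<lambda>x. x)"
  by (cases k) (auto intro!: Ck_on_SucI[where f' = "\<lambda>x v. v"] Ck_on_const simp del: Ck_on.simps(2))

lemma Ck_on_add:
  assumes "open S" "Ck_on k S f" "Ck_on k S g"
  shows "Ck_on k S (\<lambda>x. f x + g x)"
  using assms(2,3)
proof (induction k arbitrary: f g)
  case 0
  then show ?case by (auto intro: continuous_intros)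
next
  case (Suc k)
  show ?case
    using Suc by (intro Ck_on_SucI[where
          f' = "\<lambda>x v. frechet_derivative f (at x) v + frechet_derivative g (at x) v"]
        has_derivative_add \<open>open S\<close>) (auto simp: frechet_derivative_works)
qed

lemma Ck_on_sum:
  assumes "open S" "\<And>i. i \<in> I \<Longrightarrow> Ck_on k S (f i)"
  shows "Ck_on k S (\<lambda>x. \<Sum>i\<in>I. f i x)"
  using assms(2) by (induction I rule: infinite_finite_induct)
    (auto intro: Ck_on_const Ck_on_add \<open>open S\<close>)

lemma Ck_on_bilinear:
  assumes "bounded_bilinear pr" "open S" "Ck_on k S f" "Ck_on k S g"
  shows "Ck_on k S (\<lambda>x. pr (f x) (g x))"
  using assms(3,4)
proof (induction k arbitrary: f g)
  case 0
  then show ?case using assms(1) by (auto intro: bounded_bilinear.continuous_on)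
next
  case (Suc k)
  show ?case
    \<comment> \<open>In the product rule one factor stays undifferentiated; it is regarded as
      merely \<open>k\<close> times differentiable so that the induction hypothesis applies to both
      terms.\<close>
    using Suc Ck_on_Suc_imp[OF Suc.prems(1)] Ck_on_Suc_imp[OF Suc.prems(2)]
    by (intro Ck_on_SucI[where f' = "\<lambda>x v. pr (f x) (frechet_derivative g (at x) v) +
          pr (frechet_derivative f (at x) v) (g x)"]
        bounded_bilinear.FDERIV[OF assms(1)] \<open>open S\<close> Ck_on_add)
      (auto simp: frechet_derivative_works)
qed

lemma Ck_on_Pair:
  assumes "open S" "Ck_on k S f" "Ck_on k S g"
  shows "Ck_on k S (\<lambda>x. (f x, g x))"
  using assms(2,3)
proof (induction k arbitrary: f g)
  case 0
  then show ?case by (auto intro: continuous_intros)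
next
  case (Suc k)
  show ?case
    using Suc by (intro Ck_on_SucI[where
          f' = "\<lambda>x v. (frechet_derivative f (at x) v, frechet_derivative g (at x) v)"]
        has_derivative_Pair \<open>open S\<close>) (auto simp: frechet_derivative_works)
qed

section \<open>Orthogonal expansions, compact balls and the chain rule in finite dimension\<close>

definition orthogonal_basis :: "'a::real_inner set \<Rightarrow> bool"
  where "orthogonal_basis C \<longleftrightarrow> finite C \<and> (\<forall>x. x = (\<Sum>c\<in>C. (x \<bullet> c / (c \<bullet> c)) *\<^sub>R c))"

text \<open>Gram-Schmidt turns a finite spanning set into an orthogonal one. The vectors are not
  normalised, hence the denominators. The expansion has coefficients that are bounded linear in
  \<open>x\<close>, which is what the smoothness arguments use.\<close>

lemma orthogonal_basis_fin_dim: "\<exists>C :: 'a::fin_dim_inner set. orthogonal_basis C"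
proof -
  obtain S :: "'a set" where S: "finite S" "\<And>x. \<exists>u. x = (\<Sum>b\<in>S. u b *\<^sub>R b)"
    using finite_spanning by blast
  obtain C where C: "finite C" "span C = span S" "pairwise orthogonal C"
    using basis_orthogonal[OF S(1)] by blast
  have "x = (\<Sum>c\<in>C. (x \<bullet> c / (c \<bullet> c)) *\<^sub>R c)" for x
  proof -
    obtain w where "x = (\<Sum>b\<in>S. w b *\<^sub>R b)"
      using S(2) by blast
    then have "x \<in> span C"
      by (simp add: C(2) span_sum span_scale span_base)
    then obtain u where u: "x = (\<Sum>c\<in>C. u c *\<^sub>R c)"
      using C(1) by (auto simp: span_finite)
    have "x \<bullet> c = u c * (c \<bullet> c)" if "c \<in> C" for c
    proof -
      have "x \<bullet> c = (\<Sum>d\<in>C. u d * (d \<bullet> c))"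
        by (simp add: u inner_sum_left)
      also have "\<dots> = (\<Sum>d\<in>C. if d = c then u c * (c \<bullet> c) else 0)"
        using C(3) that by (intro sum.cong) (auto simp: pairwise_def orthogonal_def)
      finally show ?thesis using that C(1) by simp
    qed
    \<comment> \<open>The orthogonal set may contain 0. For \<open>c = 0\<close> the quotient is 0
      by convention, and the summand vanishes on both sides anyway.\<close>
    then have "(\<Sum>c\<in>C. (x \<bullet> c / (c \<bullet> c)) *\<^sub>R c) = (\<Sum>c\<in>C. u c *\<^sub>R c)"
      by (intro sum.cong) auto
    then show ?thesis using u by simp
  qed
  with C(1) show ?thesis unfolding orthogonal_basis_def by blast
qed

text \<open>A ball around 0 is a closed subset of a set of linear combinations with bounded
  coefficients. Such a box is compact by induction on the number of vectors: adding a vector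
  \<open>d\<close> gives a continuous image of an interval times the previous box. Translation then
  moves the centre to \<open>x\<close>.\<close>

lemma compact_cball_fin_dim: "compact (cball (x :: 'a::fin_dim_inner) r)"
proof -
  obtain C :: "'a set" where C: "orthogonal_basis C"
    using orthogonal_basis_fin_dim by blast
  define P where "P D R = {\<Sum>c\<in>D. u c *\<^sub>R c | u. \<forall>c. \<bar>u c\<bar> \<le> R c}"
    for D :: "'a set" and R :: "'a \<Rightarrow> real"
  have "compact (P D R)" if "finite D" for D R
    using that
  proof (induction D rule: finite_induct)
    case empty
    have "P {} R \<subseteq> {0}" by (auto simp: P_def)
    then show ?case using finite_subset by (intro finite_imp_compact) blast
  next
    case (insert d D)
    have "P (insert d D) R = (\<lambda>(t, y). t *\<^sub>R d + y) ` ({- R d..R d} \<times> P D R)"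
    proof (intro subset_antisym subsetI)
      fix y assume "y \<in> P (insert d D) R"
      then obtain u where u: "\<forall>c. \<bar>u c\<bar> \<le> R c" "y = (\<Sum>c\<in>insert d D. u c *\<^sub>R c)"
        unfolding P_def by blast
      then have "u d \<in> {- R d..R d}"
        by (metis abs_le_iff atLeastAtMost_iff minus_le_iff)
      moreover have "(\<Sum>c\<in>D. u c *\<^sub>R c) \<in> P D R"
        using u(1) unfolding P_def by blast
      moreover have "y = u d *\<^sub>R d + (\<Sum>c\<in>D. u c *\<^sub>R c)"
        using insert.hyps u(2) by simp
      ultimately show "y \<in> (\<lambda>(t, y). t *\<^sub>R d + y) ` ({- R d..R d} \<times> P D R)"
        by (intro image_eqI[where x = "(u d, \<Sum>c\<in>D. u c *\<^sub>R c)"]) auto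
    next
      fix y assume "y \<in> (\<lambda>(t, y). t *\<^sub>R d + y) ` ({- R d..R d} \<times> P D R)"
      then obtain t z where tz: "t \<in> {- R d..R d}" "z \<in> P D R" "y = t *\<^sub>R d + z"
        by auto
      then obtain u where "\<forall>c. \<bar>u c\<bar> \<le> R c" "z = (\<Sum>c\<in>D. u c *\<^sub>R c)"
        unfolding P_def by blast
      with tz have *: "\<bar>t\<bar> \<le> R d" "\<forall>c. \<bar>u c\<bar> \<le> R c" "y = t *\<^sub>R d + (\<Sum>c\<in>D. u c *\<^sub>R c)"
        by auto
      moreover have "(\<Sum>c\<in>D. (u(d := t)) c *\<^sub>R c) = (\<Sum>c\<in>D. u c *\<^sub>R c)"
        using insert.hyps by (intro sum.cong) auto
      ultimately have "y = (\<Sum>c\<in>insert d D. (u(d := t)) c *\<^sub>R c)"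
        "\<forall>c. \<bar>(u(d := t)) c\<bar> \<le> R c"
        using insert.hyps by simp_all
      then show "y \<in> P (insert d D) R"
        unfolding P_def by blast
    qed
    moreover have "continuous_on ({- R d..R d} \<times> P D R) (\<lambda>(t, y). t *\<^sub>R d + y)"
      by (auto simp: case_prod_unfold intro!: continuous_intros)
    ultimately show ?case
      using insert.IH by (simp add: compact_continuous_image compact_Times)
  qed
  \<comment> \<open>The bounds on the coefficients come from the Cauchy-Schwarz inequality.\<close>
  moreover have "cball 0 r \<subseteq> P C (\<lambda>c. r * norm c / (c \<bullet> c))"
  proof
    fix y :: 'a assume "y \<in> cball 0 r"
    then have "\<bar>y \<bullet> c\<bar> \<le> r * norm c" for c
      by (intro order_trans[OF Cauchy_Schwarz_ineq2]) (auto intro: mult_right_mono)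
    then have "\<bar>y \<bullet> c / (c \<bullet> c)\<bar> \<le> r * norm c / (c \<bullet> c)" for c
      by (simp add: abs_divide divide_right_mono)
    then show "y \<in> P C (\<lambda>c. r * norm c / (c \<bullet> c))"
      using C unfolding P_def orthogonal_basis_def mem_Collect_eq
      by (intro exI[where x = "\<lambda>c. y \<bullet> c / (c \<bullet> c)"] conjI allI) auto
  qed
  ultimately have "compact (P C (\<lambda>c. r * norm c / (c \<bullet> c)) \<inter> cball 0 r)"
    using C by (intro compact_Int_closed) (auto simp: orthogonal_basis_def)
  with \<open>cball 0 r \<subseteq> _\<close> have "compact (cball (0::'a) r)"
    by (simp add: inf_absorb2)
  then have "compact ((+) x ` cball 0 r)"
    by (rule compact_translation)
  then show ?thesis by simp
qed

text \<open>In the chain rule the direction in which \<open>g\<close> is differentiated varies with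
  \<open>x\<close>, whereas \<open>Ck_on\<close> speaks of fixed directions. Expanding the direction
  in an orthogonal basis of the intermediate space gives a finite sum of products of smooth
  coefficients with derivatives in fixed directions. This is where the intermediate space has to be
  finite-dimensional.\<close>

lemma Ck_on_compose:
  fixes g :: "'b::fin_dim_inner \<Rightarrow> 'c::real_normed_vector"
  assumes "open S" "open T" "f ` S \<subseteq> T" "Ck_on k S f" "Ck_on k T g"
  shows "Ck_on k S (\<lambda>x. g (f x))"
  using assms(4,5)
proof (induction k arbitrary: g)
  case 0
  then show ?case using assms(3) by (auto intro: continuous_on_compose2)
next
  case (Suc k)
  obtain C :: "'b set" where C: "orthogonal_basis C"
    using orthogonal_basis_fin_dim by blast
  let ?f' = "\<lambda>x. frechet_derivative f (at x)" and ?g' = "\<lambda>y. frechet_derivative g (at y)"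
  have lin: "linear (?g' y)" if "y \<in> T" for y
    using Ck_on_Suc_has_derivative[OF Suc.prems(2) that] has_derivative_linear by blast
  have IH: "Ck_on k S (\<lambda>x. ?g' (f x) c)" for c
    using Suc.IH[of "\<lambda>y. ?g' y c"] Suc.prems(2) Ck_on_Suc_imp[OF Suc.prems(1)] by simp
  have eq: "?g' (f x) (?f' x v) = (\<Sum>c\<in>C. (?f' x v \<bullet> c / (c \<bullet> c)) *\<^sub>R ?g' (f x) c)"
    if "x \<in> S" for x v
  proof -
    have "f x \<in> T"
      using that assms(3) by blast
    note L = lin[OF this]
    have "?f' x v = (\<Sum>c\<in>C. (?f' x v \<bullet> c / (c \<bullet> c)) *\<^sub>R c)"
      using C unfolding orthogonal_basis_def by blast
    then have "?g' (f x) (?f' x v) = ?g' (f x) (\<Sum>c\<in>C. (?f' x v \<bullet> c / (c \<bullet> c)) *\<^sub>R c)"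
      by (rule arg_cong)
    also have "\<dots> = (\<Sum>c\<in>C. (?f' x v \<bullet> c / (c \<bullet> c)) *\<^sub>R ?g' (f x) c)"
      by (simp add: linear_sum[OF L] linear_scale[OF L])
    finally show ?thesis .
  qed
  have "Ck_on k S (\<lambda>x. \<Sum>c\<in>C. (?f' x v \<bullet> c / (c \<bullet> c)) *\<^sub>R ?g' (f x) c)" for v
    using Suc.prems
    by (intro Ck_on_sum Ck_on_bilinear[OF bounded_bilinear_scaleR] IH \<open>open S\<close>
        Ck_on_bounded_linear[where L = "\<lambda>y. y \<bullet> c / (c \<bullet> c)" for c])
      (auto intro: bounded_linear_compose[OF bounded_linear_divide] bounded_linear_inner_left)
  then have D: "Ck_on k S (\<lambda>x. ?g' (f x) (?f' x v))" for v
    by (rule Ck_on_cong[OF \<open>open S\<close>]) (simp add: eq)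
  show ?case
  proof (rule Ck_on_SucI[OF \<open>open S\<close> _ D])
    fix x assume x: "x \<in> S"
    then have "f x \<in> T"
      using assms(3) by blast
    with x show "((\<lambda>x. g (f x)) has_derivative (\<lambda>v. ?g' (f x) (?f' x v))) (at x)"
      using has_derivative_compose[OF Ck_on_Suc_has_derivative[OF Suc.prems(1)]
          Ck_on_Suc_has_derivative[OF Suc.prems(2)]] by blast
  qed
qed

section \<open>Smooth step and bump functions on the model space\<close>

lemma Ck_on_inverse: "Ck_on k {0<..} (inverse :: real \<Rightarrow> real)"
proof (induction k)
  case 0
  then show ?case by (auto intro!: continuous_intros)
next
  case (Suc k)
  \<comment> \<open>The derivative of the inverse is again built from inverses by multiplication, so
    the induction closes without computing higher derivatives.\<close>
  have "Ck_on k {0<..} (\<lambda>x::real. - (inverse x * v * inverse x))" for v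
    by (intro Ck_on_bounded_linear[OF bounded_linear_minus[OF bounded_linear_ident]]
        Ck_on_bilinear[OF bounded_bilinear_mult] Suc Ck_on_const) auto
  then show ?case
    by (intro Ck_on_SucI[where f' = "\<lambda>x v. - (inverse x * v * inverse x)"]
        has_derivative_inverse') auto
qed

text \<open>This family is closed under differentiation up to linear combinations.\<close>

definition flat_fun :: "nat \<Rightarrow> real \<Rightarrow> real"
  where "flat_fun n t = (if t > 0 then inverse t ^ n * exp (- inverse t) else 0)"

lemma flat_fun_has_derivative:
  "(flat_fun n has_real_derivative flat_fun (n + 2) t - n * flat_fun (n + 1) t) (at t)"
proof (cases t "0 :: real" rule: linorder_cases)
  case less
  have "((\<lambda>t. 0) has_real_derivative 0) (at t)"
    by simp
  then have "(flat_fun n has_real_derivative 0) (at t)"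
    by (rule has_field_derivative_transform_within_open[of _ _ _ "{..<0}"])
      (use less in \<open>auto simp: flat_fun_def\<close>)
  with less show ?thesis by (simp add: flat_fun_def)
next
  case greater
  have "((\<lambda>t. inverse t ^ n * exp (- inverse t)) has_real_derivative
      flat_fun (n + 2) t - n * flat_fun (n + 1) t) (at t)"
    using greater
    by (auto intro!: derivative_eq_intros simp: flat_fun_def field_simps power2_eq_square)
       (cases n; auto simp: field_simps)
  then show ?thesis
    by (rule has_field_derivative_transform_within_open[of _ _ _ "{0<..}"])
      (use greater in \<open>auto simp: flat_fun_def\<close>)
next
  case equal
  \<comment> \<open>With \<open>x = inverse t\<close>, this is the difference quotient
    \<open>flat_fun n t / t\<close> for \<open>t > 0\<close>. The exponential dominates every power,
    so the right derivative at 0 is 0, as is the left one.\<close>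
  have "((\<lambda>x. x ^ (n + 1) / exp x) \<longlongrightarrow> 0) (at_top :: real filter)"
    by (rule tendsto_power_div_exp_0)
  then have "((\<lambda>t. inverse t ^ (n + 1) / exp (inverse t)) \<longlongrightarrow> (0::real)) (at_right 0)"
    by (rule filterlim_compose[OF _ filterlim_inverse_at_top_right])
  then have "((\<lambda>t. flat_fun n t / t) \<longlongrightarrow> 0) (at_right 0)"
    by (rule Lim_transform_eventually)
      (auto simp: eventually_at_filter flat_fun_def exp_minus field_simps)
  moreover have "((\<lambda>t. flat_fun n t / t) \<longlongrightarrow> 0) (at_left 0)"
    by (rule Lim_transform_eventually[OF tendsto_const])
      (auto simp: eventually_at_filter flat_fun_def)
  ultimately have "((\<lambda>t. flat_fun n t / t) \<longlongrightarrow> 0) (at 0)"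
    by (simp add: filterlim_split_at)
  with equal show ?thesis
    by (simp add: has_field_derivative_iff flat_fun_def)
qed

lemma Ck_on_flat_fun: "Ck_on k UNIV (flat_fun n)"
proof (induction k arbitrary: n)
  case 0
  then show ?case
    by (auto intro!: DERIV_continuous_on flat_fun_has_derivative)
next
  case (Suc k)
  have "Ck_on k UNIV (\<lambda>t. (flat_fun (n + 2) t + (- n) * flat_fun (n + 1) t) * v)" for v
    by (intro Ck_on_add Ck_on_bilinear[OF bounded_bilinear_mult] Suc Ck_on_const) auto
  then show ?case
    using flat_fun_has_derivative
    by (intro Ck_on_SucI[where f' = "\<lambda>t v. (flat_fun (n + 2) t + (- n) * flat_fun (n + 1) t) * v"])
      (auto simp: has_field_derivative_def)
qed

text \<open>The witness is \<open>F / (F + G)\<close>, where \<open>F\<close> is positive exactly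
  for \<open>t < b\<close> and \<open>G\<close> exactly for \<open>t > a\<close>. As
  \<open>a < b\<close>, at least one of them is positive everywhere, so the denominator never
  vanishes.\<close>

lemma smooth_step_exists:
  fixes a b :: real
  assumes "a < b"
  obtains \<psi> :: "real \<Rightarrow> real" where "smooth_on UNIV \<psi>"
    "\<And>t. t \<le> a \<Longrightarrow> \<psi> t = 1" "\<And>t. t \<ge> b \<Longrightarrow> \<psi> t = 0"
proof
  let ?F = "\<lambda>t. flat_fun 0 (b - t)" and ?G = "\<lambda>t. flat_fun 0 (t - a)"
  have F: "Ck_on k UNIV ?F" and G: "Ck_on k UNIV ?G" for k
    using Ck_on_add[OF open_UNIV Ck_on_const Ck_on_ident[OF open_UNIV], of k "- a"]
      Ck_on_add[OF open_UNIV Ck_on_const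
        Ck_on_bounded_linear[OF bounded_linear_minus[OF bounded_linear_ident] open_UNIV Ck_on_ident],
        of k b]
    by (auto intro: Ck_on_compose[OF _ _ _ _ Ck_on_flat_fun, where S = UNIV])
  have pos: "?F t + ?G t > 0" for t
    using assms by (auto simp: flat_fun_def intro: add_pos_pos)
  show "smooth_on UNIV (\<lambda>t. ?F t * inverse (?F t + ?G t))"
    unfolding smooth_on_def
    by (intro allI Ck_on_bilinear[OF bounded_bilinear_mult] F
        Ck_on_compose[OF _ _ _ _ Ck_on_inverse] Ck_on_add G) (use pos in auto)
  show "?F t * inverse (?F t + ?G t) = 1" if "t \<le> a" for t
    using that assms by (simp add: flat_fun_def)
  show "?F t * inverse (?F t + ?G t) = 0" if "t \<ge> b" for t
    using that by (simp add: flat_fun_def)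
qed

text \<open>A step function is applied to the squared distance from \<open>x0\<close>, which, unlike
  the distance, is smooth at \<open>x0\<close>. This explains the squared thresholds
  \<open>(r / 2)\<^sup>2\<close> and \<open>r\<^sup>2\<close>.\<close>

lemma smooth_bump_ball:
  fixes x0 :: "'a::fin_dim_inner"
  assumes "r > 0"
  obtains \<beta> :: "'a \<Rightarrow> real" where "smooth_on UNIV \<beta>"
    "\<And>x. x \<in> ball x0 (r / 2) \<Longrightarrow> \<beta> x = 1" "\<And>x. x \<notin> cball x0 r \<Longrightarrow> \<beta> x = 0"
proof -
  obtain \<psi> :: "real \<Rightarrow> real" where \<psi>: "smooth_on UNIV \<psi>"
    "\<And>t. t \<le> (r / 2)\<^sup>2 \<Longrightarrow> \<psi> t = 1" "\<And>t. t \<ge> r\<^sup>2 \<Longrightarrow> \<psi> t = 0"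
    using smooth_step_exists[of "(r / 2)\<^sup>2" "r\<^sup>2"] assms by (auto simp: power2_eq_square)
  have "Ck_on k UNIV (\<lambda>x::'a. - x0 + x)" for k
    by (intro Ck_on_add Ck_on_const Ck_on_ident) auto
  then have "Ck_on k UNIV (\<lambda>x. (- x0 + x) \<bullet> (- x0 + x))" for k
    by (intro Ck_on_bilinear[OF bounded_bilinear_inner]) auto
  moreover have "Ck_on k UNIV \<psi>" for k
    using \<psi>(1) by (simp add: smooth_on_def)
  ultimately have "Ck_on k UNIV (\<lambda>x. \<psi> ((- x0 + x) \<bullet> (- x0 + x)))" for k
    by (rule Ck_on_compose[OF open_UNIV open_UNIV subset_UNIV])
  then have "smooth_on UNIV (\<lambda>x. \<psi> ((- x0 + x) \<bullet> (- x0 + x)))"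
    by (simp add: smooth_on_def)
  moreover have "(- x0 + x) \<bullet> (- x0 + x) = (dist x0 x)\<^sup>2" for x
    by (metis dist_commute dist_norm power2_norm_eq_inner uminus_add_conv_diff)
  ultimately have "smooth_on UNIV (\<lambda>x. \<psi> ((dist x0 x)\<^sup>2))"
    by simp
  moreover have "\<psi> ((dist x0 x)\<^sup>2) = 1" if "x \<in> ball x0 (r / 2)" for x
    using that by (intro \<psi>(2) power_mono) auto
  moreover have "\<psi> ((dist x0 x)\<^sup>2) = 0" if "x \<notin> cball x0 r" for x
    using that assms by (intro \<psi>(3) power_mono) auto
  ultimately show ?thesis
    by (rule that)
qed


section \<open>Smooth functions on manifolds\<close>

text \<open>In a Hausdorff space \<open>K\<close> is closed, so it contains the closure of the set
  where \<open>s\<close> is nonzero. Together with the converse below, this replaces reasoning about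
  closures by vanishing off some compact set.\<close>

lemma compactly_supportedI:
  fixes s :: "'m::t2_space \<Rightarrow> 'v::zero"
  assumes "compact K" "\<And>q. q \<notin> K \<Longrightarrow> s q = 0"
  shows "compactly_supported s"
proof -
  have "closure {p. s p \<noteq> 0} \<subseteq> K"
    using assms by (intro closure_minimal compact_imp_closed) auto
  then show ?thesis
    using compact_Int_closed[OF assms(1), of "closure {p. s p \<noteq> 0}"]
    by (simp add: compactly_supported_def inf_absorb2)
qed

lemma compactly_supportedE:
  assumes "compactly_supported s"
  obtains K where "compact K" "\<And>q. q \<notin> K \<Longrightarrow> s q = 0"
proof (rule that)
  show "compact (closure {p. s p \<noteq> 0})"
    using assms by (simp add: compactly_supported_def)
  show "s q = 0" if "q \<notin> closure {p. s p \<noteq> 0}" for q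
    using that closure_subset[of "{p. s p \<noteq> 0}"] by blast
qed

locale manifold =
  fixes M :: "('m::{t2_space, second_countable_topology}, 'e::fin_dim_inner) atlas"
  assumes manifold: "smooth_manifold M"
begin

lemma charts_cover: "\<exists>(U, \<kappa>)\<in>M. p \<in> U"
proof -
  have "p \<in> (\<Union>(U, \<kappa>)\<in>M. U)"
    using manifold by (simp add: smooth_manifold_def)
  then show ?thesis by auto
qed

lemma chart_props:
  assumes "(U, \<kappa>) \<in> M"
  shows "open U" "open (\<kappa> ` U)" "homeomorphism U (\<kappa> ` U) \<kappa> (the_inv_into U \<kappa>)"
  using manifold assms by (auto simp: smooth_manifold_def)

lemma chart_inverse:
  assumes "(U, \<kappa>) \<in> M" "p \<in> U"
  shows "the_inv_into U \<kappa> (\<kappa> p) = p"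
  using homeomorphism_apply1[OF chart_props(3)[OF assms(1)] assms(2)] .

lemma open_chart_image:
  assumes "(U, \<kappa>) \<in> M" "open W"
  shows "open (\<kappa> ` (U \<inter> W))"
proof -
  have "openin (top_of_set (\<kappa> ` U)) (\<kappa> ` (U \<inter> W))"
    using assms(2) by (intro homeomorphism_imp_open_map[OF chart_props(3)[OF assms(1)]])
      (simp add: openin_open_Int)
  then show ?thesis
    using chart_props(2)[OF assms(1)] by (rule openin_open_trans)
qed

lemma smooth_fun_onI:
  assumes "\<And>U \<kappa> k. (U, \<kappa>) \<in> M \<Longrightarrow> Ck_on k (\<kappa> ` (U \<inter> W)) (\<lambda>x. g (the_inv_into U \<kappa> x))"
  shows "smooth_fun_on M W g"
  using assms by (auto simp: smooth_fun_on_def smooth_on_def o_def)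

lemma smooth_fun_onD:
  assumes "smooth_fun_on M W g" "(U, \<kappa>) \<in> M"
  shows "Ck_on k (\<kappa> ` (U \<inter> W)) (\<lambda>x. g (the_inv_into U \<kappa> x))"
  using assms by (auto simp: smooth_fun_on_def smooth_on_def o_def)

lemma smooth_fun_on_cong:
  assumes "open W" "smooth_fun_on M W g" "\<And>p. p \<in> W \<Longrightarrow> g p = h p"
  shows "smooth_fun_on M W h"
proof (rule smooth_fun_onI)
  fix U \<kappa> k assume U: "(U, \<kappa>) \<in> M"
  show "Ck_on k (\<kappa> ` (U \<inter> W)) (\<lambda>x. h (the_inv_into U \<kappa> x))"
    using assms(3)
    by (intro Ck_on_cong[OF open_chart_image[OF U assms(1)] smooth_fun_onD[OF assms(2) U]])
      (auto simp: chart_inverse[OF U])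
qed

lemma smooth_fun_on_subset: "smooth_fun_on M W g \<Longrightarrow> V \<subseteq> W \<Longrightarrow> smooth_fun_on M V g"
  by (rule smooth_fun_onI) (auto intro: Ck_on_subset[OF smooth_fun_onD])

lemma smooth_fun_on_Union:
  assumes "\<forall>W\<in>\<W>. open W \<and> smooth_fun_on M W g"
  shows "smooth_fun_on M (\<Union>\<W>) g"
proof (rule smooth_fun_onI)
  fix U \<kappa> k assume U: "(U, \<kappa>) \<in> M"
  have "Ck_on k (\<Union>W\<in>\<W>. \<kappa> ` (U \<inter> W)) (\<lambda>x. g (the_inv_into U \<kappa> x))"
    using assms by (intro Ck_on_Union) (auto intro: open_chart_image[OF U] smooth_fun_onD[OF _ U])
  moreover have "\<kappa> ` (U \<inter> \<Union>\<W>) = (\<Union>W\<in>\<W>. \<kappa> ` (U \<inter> W))"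
    by blast
  ultimately show "Ck_on k (\<kappa> ` (U \<inter> \<Union>\<W>)) (\<lambda>x. g (the_inv_into U \<kappa> x))"
    by (simp only:)
qed

lemma smooth_fun_on_UnI:
  assumes "open V" "open W" "smooth_fun_on M V g" "smooth_fun_on M W g"
  shows "smooth_fun_on M (V \<union> W) g"
  using smooth_fun_on_Union[of "{V, W}" g] assms by simp

lemma smooth_fun_on_const: "smooth_fun_on M W (\<lambda>p. c)"
  by (rule smooth_fun_onI, intro Ck_on_const)

lemma smooth_fun_on_add:
  assumes "open W" "smooth_fun_on M W g" "smooth_fun_on M W h"
  shows "smooth_fun_on M W (\<lambda>p. g p + h p)"
  by (rule smooth_fun_onI, intro Ck_on_add open_chart_image smooth_fun_onD assms)

lemma smooth_fun_on_bilinear: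
  assumes "bounded_bilinear pr" "open W" "smooth_fun_on M W g" "smooth_fun_on M W h"
  shows "smooth_fun_on M W (\<lambda>p. pr (g p) (h p))"
  by (rule smooth_fun_onI, intro Ck_on_bilinear[OF assms(1)] open_chart_image smooth_fun_onD assms)

lemma smooth_fun_on_bounded_linear:
  assumes "bounded_linear L" "open W" "smooth_fun_on M W g"
  shows "smooth_fun_on M W (\<lambda>p. L (g p))"
  by (rule smooth_fun_onI, intro Ck_on_bounded_linear[OF assms(1)] open_chart_image smooth_fun_onD assms)

lemma smooth_fun_on_Pair:
  assumes "open W" "smooth_fun_on M W g" "smooth_fun_on M W h"
  shows "smooth_fun_on M W (\<lambda>p. (g p, h p))"
  by (rule smooth_fun_onI, intro Ck_on_Pair open_chart_image smooth_fun_onD assms)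

lemma smooth_fun_on_compose:
  fixes g :: "'m \<Rightarrow> 'w::fin_dim_inner"
  assumes "open W" "open T" "g ` W \<subseteq> T" "smooth_fun_on M W g" "smooth_on T h"
  shows "smooth_fun_on M W (\<lambda>p. h (g p))"
proof (rule smooth_fun_onI)
  fix U \<kappa> k assume U: "(U, \<kappa>) \<in> M"
  show "Ck_on k (\<kappa> ` (U \<inter> W)) (\<lambda>x. h (g (the_inv_into U \<kappa> x)))"
    by (rule Ck_on_compose[OF open_chart_image[OF U assms(1)] assms(2) _ smooth_fun_onD[OF assms(4) U]])
      (use assms(3,5) in \<open>auto simp: chart_inverse[OF U] smooth_on_def\<close>)
qed

text \<open>This is the smoothness of the coordinate changes.\<close>

lemma smooth_fun_on_chart: "(V, \<mu>) \<in> M \<Longrightarrow> smooth_fun_on M V \<mu>"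
  using manifold by (fastforce simp: smooth_manifold_def smooth_fun_on_def)

text \<open>A bump function in coordinates is extended by 0. Its support lies in the preimage
  \<open>K\<close> of a closed coordinate ball, which is compact and therefore closed. Hence the
  chart domain and \<open>- K\<close> are two open sets that cover the manifold, and the extension
  is smooth on each.\<close>

lemma bump_exists:
  assumes "open W" "p \<in> W"
  obtains \<eta> N K where "\<eta> \<in> Cinf M" "open N" "p \<in> N" "\<And>q. q \<in> N \<Longrightarrow> \<eta> q = 1"
    "compact K" "K \<subseteq> W" "\<And>q. q \<notin> K \<Longrightarrow> \<eta> q = 0"
proof -
  obtain U \<kappa> where U: "(U, \<kappa>) \<in> M" "p \<in> U"
    using charts_cover by blast
  note oU = chart_props(1)[OF U(1)] and hom = chart_props(3)[OF U(1)]
  obtain r where r: "r > 0" "cball (\<kappa> p) r \<subseteq> \<kappa> ` (U \<inter> W)"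
    using open_contains_cball_eq[OF open_chart_image[OF U(1) assms(1)]] assms(2) U(2) by blast
  obtain \<beta> where \<beta>: "smooth_on UNIV \<beta>"
    "\<And>x. x \<in> ball (\<kappa> p) (r / 2) \<Longrightarrow> \<beta> x = (1::real)" "\<And>x. x \<notin> cball (\<kappa> p) r \<Longrightarrow> \<beta> x = 0"
    using smooth_bump_ball[OF r(1)] by metis
  define K where "K = the_inv_into U \<kappa> ` cball (\<kappa> p) r"
  \<comment> \<open>The case distinction is essential: outside \<open>U\<close> the values of
    \<open>\<kappa>\<close> are arbitrary.\<close>
  define \<eta> where "\<eta> q = (if q \<in> U then \<beta> (\<kappa> q) else 0)" for q
  have "continuous_on (cball (\<kappa> p) r) (the_inv_into U \<kappa>)"
    using r(2) by (intro continuous_on_subset[OF homeomorphism_cont2[OF hom]]) auto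
  then have K: "compact K"
    unfolding K_def using compact_cball_fin_dim by (rule compact_continuous_image)
  have KW: "K \<subseteq> U \<inter> W"
    using r(2) chart_inverse[OF U(1)] by (fastforce simp: K_def)
  have zero: "\<eta> q = 0" if "q \<notin> K" for q
    using that chart_inverse[OF U(1), of q] \<beta>(3)[of "\<kappa> q"] unfolding \<eta>_def K_def by force
  have cl: "open (- K)"
    using K by (simp add: compact_imp_closed open_Compl)
  have "smooth_fun_on M U (\<lambda>q. \<beta> (\<kappa> q))"
    by (intro smooth_fun_on_compose[OF oU open_UNIV _ smooth_fun_on_chart] U \<beta>) simp
  then have "smooth_fun_on M U \<eta>"
    by (rule smooth_fun_on_cong[OF oU]) (simp add: \<eta>_def)
  moreover have "smooth_fun_on M (- K) \<eta>"
    by (rule smooth_fun_on_cong[OF cl smooth_fun_on_const[where c = 0]]) (simp add: zero)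
  ultimately have "smooth_fun_on M (U \<union> - K) \<eta>"
    by (intro smooth_fun_on_UnI oU cl)
  moreover have "U \<union> - K = UNIV"
    using KW by blast
  ultimately have 1: "\<eta> \<in> Cinf M"
    by (simp add: Cinf_def)
  obtain N where N: "open N" "N = U \<inter> \<kappa> -` ball (\<kappa> p) (r / 2)"
    using continuous_open_preimage[OF homeomorphism_cont1[OF hom] oU open_ball] by blast
  show ?thesis
    using 1 N(1) _ _ K _ zero
  proof (rule that)
    show "p \<in> N" "K \<subseteq> W"
      using N U KW r(1) by auto
    show "\<eta> q = 1" if "q \<in> N" for q
      using that N \<beta>(2) by (simp add: \<eta>_def)
  qed
qed

end

text \<open>Over a chart \<open>(V, \<mu>)\<close> of \<open>M\<close>, the composite factors as
  \<open>g\<close> in coordinates after \<open>\<mu>\<close> composed with \<open>f\<close>, both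
  smooth. The preimages of the chart domains cover, so the pieces glue.\<close>

lemma smooth_fun_on_pullback:
  fixes B :: "('b::{t2_space, second_countable_topology}, 'd::fin_dim_inner) atlas"
    and M :: "('m::{t2_space, second_countable_topology}, 'e::fin_dim_inner) atlas"
  assumes B: "smooth_manifold B" and M: "smooth_manifold M" and f: "smooth_map B M f"
    and W: "open W" and g: "smooth_fun_on M W g"
  shows "smooth_fun_on B (f -` W) (\<lambda>p. g (f p))"
proof -
  interpret B: manifold B by (rule manifold.intro[OF B])
  interpret M: manifold M by (rule manifold.intro[OF M])
  have cont: "continuous_on UNIV f"
    using f by (simp add: smooth_map_def)
  have part: "smooth_fun_on B (f -` (V \<inter> W)) (\<lambda>p. g (f p))" if V: "(V, \<mu>) \<in> M" for V \<mu>
  proof -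
    have oV: "open V"
      by (rule M.chart_props[OF V])
    have o: "open (f -` (V \<inter> W))"
      by (rule open_vimage[OF open_Int[OF oV W] cont])
    have "smooth_fun_on B (f -` V) (\<lambda>p. \<mu> (f p))"
      using f V by (auto simp: smooth_map_def smooth_fun_on_def comp_def)
    then have "smooth_fun_on B (f -` (V \<inter> W)) (\<lambda>p. \<mu> (f p))"
      by (rule B.smooth_fun_on_subset) auto
    moreover have "smooth_on (\<mu> ` (V \<inter> W)) (\<lambda>x. g (the_inv_into V \<mu> x))"
      using M.smooth_fun_onD[OF g V] by (simp add: smooth_on_def)
    moreover have "(\<lambda>p. \<mu> (f p)) ` (f -` (V \<inter> W)) \<subseteq> \<mu> ` (V \<inter> W)"
      by auto
    ultimately have "smooth_fun_on B (f -` (V \<inter> W)) (\<lambda>p. g (the_inv_into V \<mu> (\<mu> (f p))))"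
      by (rule B.smooth_fun_on_compose[OF o M.open_chart_image[OF V W], rotated])
    then show ?thesis
      by (rule B.smooth_fun_on_cong[OF o]) (simp add: M.chart_inverse[OF V])
  qed
  have "smooth_fun_on B (\<Union>((\<lambda>(V, \<mu>). f -` (V \<inter> W)) ` M)) (\<lambda>p. g (f p))"
    using part M.chart_props(1) W cont
    by (intro B.smooth_fun_on_Union) (auto intro!: open_vimage)
  moreover have "(\<Union>((\<lambda>(V, \<mu>). f -` (V \<inter> W)) ` M)) = f -` W"
    using M.charts_cover by fastforce
  ultimately show ?thesis by simp
qed


section \<open>Sections of vector bundles\<close>

lemma fibre_linear_zero:
  assumes "fibre_linear S L" "subspace S"
  shows "L 0 = 0"
proof -
  have "L (0 *\<^sub>R 0) = 0 *\<^sub>R L 0"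
    using assms unfolding fibre_linear_def subspace_def by blast
  then show ?thesis by simp
qed

lemma fibre_linear_sum:
  assumes L: "fibre_linear S L" and S: "subspace S" and v: "\<And>i. i \<in> I \<Longrightarrow> v i \<in> S"
  shows "L (\<Sum>i\<in>I. c i *\<^sub>R v i) = (\<Sum>i\<in>I. c i *\<^sub>R L (v i))"
  using v
proof (induction I rule: infinite_finite_induct)
  case (insert i I)
  have "c i *\<^sub>R v i \<in> S" "(\<Sum>i\<in>I. c i *\<^sub>R v i) \<in> S"
    using insert.prems S by (auto intro: subspace_sum subspace_scale)
  then show ?case
    using insert L by (simp add: fibre_linear_def)
qed (auto simp: fibre_linear_zero[OF L S])

lemma sum_apply: "(\<Sum>i\<in>I. g i) x = (\<Sum>i\<in>I. g i x)"
  by (induction I rule: infinite_finite_induct) auto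

lemma sections_smooth:
  "s \<in> sections M E \<Longrightarrow> (U, \<phi>) \<in> trivs E \<Longrightarrow> smooth_fun_on M U (\<lambda>p. \<phi> p (s p))"
  by (auto simp: sections_def)

lemma sections_fibre: "s \<in> sections M E \<Longrightarrow> s p \<in> fibre E p"
  by (simp add: sections_def)

section \<open>Sections of a vector bundle and local frames\<close>

locale smooth_bundle = manifold M
  for M :: "('m::{t2_space, second_countable_topology}, 'e::fin_dim_inner) atlas" +
  fixes E :: "('m, 'v::real_vector, 'r::fin_dim_inner, 'x) vbundle_scheme"
  assumes vector_bundle: "vector_bundle M E"
begin

lemma fibre_subspace: "subspace (fibre E p)"
  using vector_bundle by (simp add: vector_bundle_def)

lemma trivs_cover: "\<exists>(U, \<phi>)\<in>trivs E. p \<in> U"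
proof -
  have "p \<in> (\<Union>(U, \<phi>)\<in>trivs E. U)"
    using vector_bundle by (simp add: vector_bundle_def)
  then show ?thesis by auto
qed

lemma triv_props:
  assumes "(U, \<phi>) \<in> trivs E"
  shows "open U" "p \<in> U \<Longrightarrow> fibre_linear (fibre E p) (\<phi> p)"
    "p \<in> U \<Longrightarrow> bij_betw (\<phi> p) (fibre E p) UNIV"
  using vector_bundle assms by (auto simp: vector_bundle_def)

lemma transition_smooth:
  assumes "(U, \<phi>) \<in> trivs E" "(V, \<psi>) \<in> trivs E"
  shows "smooth_fun_on M (U \<inter> V) (\<lambda>p. \<psi> p (the_inv_into (fibre E p) (\<phi> p) x))"
  using vector_bundle assms by (fastforce simp: vector_bundle_def)

lemma sections_smult:
  assumes "g \<in> Cinf M" "s \<in> sections M E"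
  shows "(\<lambda>p. g p *\<^sub>R s p) \<in> sections M E"
proof -
  have "smooth_fun_on M U (\<lambda>p. \<phi> p (g p *\<^sub>R s p))" if U: "(U, \<phi>) \<in> trivs E" for U \<phi>
  proof -
    have "smooth_fun_on M U (\<lambda>p. g p *\<^sub>R \<phi> p (s p))"
      using assms sections_smooth[OF assms(2) U] triv_props(1)[OF U]
      by (intro smooth_fun_on_bilinear[OF bounded_bilinear_scaleR])
        (auto simp: Cinf_def intro: smooth_fun_on_subset)
    then show ?thesis
      by (rule smooth_fun_on_cong[OF triv_props(1)[OF U]])
        (use triv_props(2)[OF U] sections_fibre[OF assms(2)] in \<open>simp add: fibre_linear_def\<close>)
  qed
  then show ?thesis
    using sections_fibre[OF assms(2)] fibre_subspace by (auto simp: sections_def subspace_scale)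
qed

lemma subspace_sections: "subspace (sections M E)"
proof (rule subspaceI)
  have "smooth_fun_on M U (\<lambda>p. \<phi> p 0)" if U: "(U, \<phi>) \<in> trivs E" for U \<phi>
    by (rule smooth_fun_on_cong[OF triv_props(1)[OF U] smooth_fun_on_const[where c = 0]])
      (simp add: fibre_linear_zero[OF triv_props(2)[OF U] fibre_subspace])
  then show "0 \<in> sections M E"
    using fibre_subspace by (auto simp: sections_def subspace_0)
next
  fix s t assume st: "s \<in> sections M E" "t \<in> sections M E"
  have "smooth_fun_on M U (\<lambda>p. \<phi> p (s p + t p))" if U: "(U, \<phi>) \<in> trivs E" for U \<phi>
    by (rule smooth_fun_on_cong[OF triv_props(1)[OF U]
          smooth_fun_on_add[OF triv_props(1)[OF U] st[THEN sections_smooth[OF _ U]]]])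
      (use triv_props(2)[OF U] st[THEN sections_fibre] in \<open>simp add: fibre_linear_def\<close>)
  then show "s + t \<in> sections M E"
    using st[THEN sections_fibre] fibre_subspace by (auto simp: sections_def subspace_add)
next
  fix c s assume "s \<in> sections M E"
  moreover have "(\<lambda>p. c) \<in> Cinf M"
    by (simp add: Cinf_def smooth_fun_on_const)
  ultimately show "c *\<^sub>R s \<in> sections M E"
    unfolding scaleR_fun_def by (rule sections_smult[rotated])
qed

text \<open>The frame that a trivialisation assigns to constant vectors is multiplied by a bump
  function, which makes its members global sections with compact support. Where the bump function is
  1 nothing has changed, and the coordinates of \<open>v\<close> give the coefficients.\<close>

lemma local_generators:
  obtains U \<phi> W C e where "(U, \<phi>) \<in> trivs E" "open W" "p \<in> W" "W \<subseteq> U" "finite C"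
    "\<And>c. e c \<in> sections_c M E"
    "\<And>q v. q \<in> W \<Longrightarrow> v \<in> fibre E q \<Longrightarrow> v = (\<Sum>c\<in>C. (\<phi> q v \<bullet> c / (c \<bullet> c)) *\<^sub>R e c q)"
proof -
  obtain U \<phi> where U: "(U, \<phi>) \<in> trivs E" "p \<in> U"
    using trivs_cover by blast
  obtain C :: "'r set" where C: "orthogonal_basis C"
    using orthogonal_basis_fin_dim by blast
  obtain \<beta> N K where \<beta>: "\<beta> \<in> Cinf M" "open N" "p \<in> N" "\<And>q. q \<in> N \<Longrightarrow> \<beta> q = 1"
    "compact K" "K \<subseteq> U" "\<And>q. q \<notin> K \<Longrightarrow> \<beta> q = 0"
    using bump_exists[OF triv_props(1)[OF U(1)] U(2)] by metis
  let ?inv = "\<lambda>q. the_inv_into (fibre E q) (\<phi> q)"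
  define e where "e c q = (if q \<in> U then \<beta> q *\<^sub>R ?inv q c else 0)" for c q
  have cl: "open (- K)"
    using \<beta>(5) by (simp add: compact_imp_closed open_Compl)
  have inv: "?inv q c \<in> fibre E q" "\<phi> q (?inv q c) = c" if "q \<in> U" for q c
    using triv_props(3)[OF U(1) that]
    by (auto simp: bij_betw_def intro: the_inv_into_into f_the_inv_into_f)
  have zero: "e c q = 0" if "q \<notin> K" for c q
    using that \<beta>(7) by (simp add: e_def)
  have fib: "e c q \<in> fibre E q" for c q
    using inv(1) fibre_subspace by (auto simp: e_def subspace_scale subspace_0)
  \<comment> \<open>In another trivialisation over \<open>V\<close>, the cut-off frame is given by
    transition functions on \<open>U \<inter> V\<close> and is 0 on \<open>V \<inter> - K\<close>.
    These two open sets cover \<open>V\<close> because \<open>K\<close> lies in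
    \<open>U\<close>.\<close>
  have sm: "smooth_fun_on M V (\<lambda>q. \<psi> q (e c q))" if V: "(V, \<psi>) \<in> trivs E" for V \<psi> c
  proof -
    have oV: "open V" and oU: "open U"
      using triv_props(1) U V by blast+
    have "smooth_fun_on M (U \<inter> V) (\<lambda>q. \<beta> q *\<^sub>R \<psi> q (?inv q c))"
      using \<beta>(1) oU oV
      by (intro smooth_fun_on_bilinear[OF bounded_bilinear_scaleR] transition_smooth[OF U(1) V])
        (auto simp: Cinf_def intro: smooth_fun_on_subset)
    then have 1: "smooth_fun_on M (U \<inter> V) (\<lambda>q. \<psi> q (e c q))"
      by (rule smooth_fun_on_cong[rotated])
        (use oU oV triv_props(2)[OF V] inv(1) in \<open>auto simp: e_def fibre_linear_def\<close>)
    have 2: "smooth_fun_on M (V \<inter> - K) (\<lambda>q. \<psi> q (e c q))"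
      by (rule smooth_fun_on_cong[OF open_Int[OF oV cl] smooth_fun_on_const[where c = 0]])
        (simp add: zero fibre_linear_zero[OF triv_props(2)[OF V] fibre_subspace])
    have "smooth_fun_on M ((U \<inter> V) \<union> (V \<inter> - K)) (\<lambda>q. \<psi> q (e c q))"
      by (rule smooth_fun_on_UnI[OF open_Int[OF oU oV] open_Int[OF oV cl] 1 2])
    moreover have "(U \<inter> V) \<union> (V \<inter> - K) = V"
      using \<beta>(6) by blast
    ultimately show ?thesis by simp
  qed
  show ?thesis
  proof (rule that[OF U(1)])
    show "open (N \<inter> U)" "p \<in> N \<inter> U" "N \<inter> U \<subseteq> U" "finite C"
      using \<beta>(2,3) U(2) triv_props(1)[OF U(1)] C by (auto simp: orthogonal_basis_def)
    show "e c \<in> sections_c M E" for c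
      using fib sm compactly_supportedI[OF \<beta>(5) zero] by (auto simp: sections_c_def sections_def)
    show "v = (\<Sum>c\<in>C. (\<phi> q v \<bullet> c / (c \<bullet> c)) *\<^sub>R e c q)"
      if q: "q \<in> N \<inter> U" and v: "v \<in> fibre E q" for q v
    proof -
      have lin: "fibre_linear (fibre E q) (\<phi> q)" and bij: "bij_betw (\<phi> q) (fibre E q) UNIV"
        using q triv_props(2,3)[OF U(1)] by blast+
      have e: "\<phi> q (e c q) = c" for c
        using q inv(2) \<beta>(4) by (simp add: e_def)
      have "\<phi> q (\<Sum>c\<in>C. (\<phi> q v \<bullet> c / (c \<bullet> c)) *\<^sub>R e c q) =
          (\<Sum>c\<in>C. (\<phi> q v \<bullet> c / (c \<bullet> c)) *\<^sub>R c)"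
        using fibre_linear_sum[OF lin fibre_subspace fib] by (simp add: e)
      also have "\<dots> = \<phi> q v"
        using C unfolding orthogonal_basis_def by metis
      \<comment> \<open>Both sides lie in the fibre and have the same coordinates, so injectivity of
        \<open>\<phi> q\<close> on the fibre gives equality.\<close>
      finally show ?thesis
        using bij v fib fibre_subspace
        by (metis (no_types, lifting) bij_betw_inv_into_left subspace_scale subspace_sum)
    qed
  qed
qed

end

section \<open>The pullback bundle and generators of its compactly supported sections\<close>

locale bundle_pullback = smooth_bundle M E + B: manifold B
  for M :: "('m::{t2_space, second_countable_topology}, 'e::fin_dim_inner) atlas"
    and E :: "('m, 'v::real_vector, 'r::fin_dim_inner, 'x) vbundle_scheme"
    and B :: "('b::{t2_space, second_countable_topology}, 'd::fin_dim_inner) atlas" +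
  fixes f :: "'b \<Rightarrow> 'm"
  assumes smooth_map: "smooth_map B M f"
begin

lemma open_preimage: "open W \<Longrightarrow> open (f -` W)"
  using smooth_map by (auto simp: smooth_map_def intro: open_vimage)

lemma smooth_preimage:
  "open W \<Longrightarrow> smooth_fun_on M W g \<Longrightarrow> smooth_fun_on B (f -` W) (\<lambda>p. g (f p))"
  by (rule smooth_fun_on_pullback[OF B.manifold manifold smooth_map])

lemma pullback_trivs:
  "(U, \<phi>) \<in> trivs (pullback_bundle f E) \<longleftrightarrow>
    (\<exists>V \<psi>. (V, \<psi>) \<in> trivs E \<and> U = f -` V \<and> \<phi> = (\<lambda>p. \<psi> (f p)))"
  by (auto simp: pullback_bundle_def)

lemma pullback_fib [simp]: "fibre (pullback_bundle f E) p = fibre E (f p)"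
  by (simp add: pullback_bundle_def)

lemma pullback_vector_bundle: "vector_bundle B (pullback_bundle f E)"
  unfolding vector_bundle_def pullback_fib
proof (intro conjI allI)
  show "subspace (fibre E (f p))" for p
    by (rule fibre_subspace)
  show "(\<Union>(U, \<phi>)\<in>trivs (pullback_bundle f E). U) = UNIV"
  proof (intro equalityI subsetI UNIV_I)
    fix p
    obtain U \<phi> where "(U, \<phi>) \<in> trivs E" "f p \<in> U"
      using trivs_cover by blast
    then have "(f -` U, \<lambda>p. \<phi> (f p)) \<in> trivs (pullback_bundle f E)" "p \<in> f -` U"
      by (auto simp: pullback_trivs)
    then show "p \<in> (\<Union>(U, \<phi>)\<in>trivs (pullback_bundle f E). U)"
      by blast
  qed
  show "\<forall>(U, \<phi>)\<in>trivs (pullback_bundle f E). open U \<and>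
      (\<forall>p\<in>U. fibre_linear (fibre E (f p)) (\<phi> p) \<and> bij_betw (\<phi> p) (fibre E (f p)) UNIV)"
    using open_preimage[OF triv_props(1)] by (auto simp: pullback_trivs intro: triv_props)
  show "\<forall>(U, \<phi>)\<in>trivs (pullback_bundle f E). \<forall>(V, \<psi>)\<in>trivs (pullback_bundle f E). \<forall>x.
      smooth_fun_on B (U \<inter> V) (\<lambda>p. \<psi> p (the_inv_into (fibre E (f p)) (\<phi> p) x))"
  proof clarify
    fix U \<phi> V \<psi> x
    assume "(U, \<phi>) \<in> trivs (pullback_bundle f E)" "(V, \<psi>) \<in> trivs (pullback_bundle f E)"
    then obtain U' \<phi>' V' \<psi>' where *: "(U', \<phi>') \<in> trivs E" "(V', \<psi>') \<in> trivs E"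
      "U = f -` U'" "V = f -` V'" "\<phi> = (\<lambda>p. \<phi>' (f p))" "\<psi> = (\<lambda>p. \<psi>' (f p))"
      unfolding pullback_trivs by blast
    have "smooth_fun_on B (f -` (U' \<inter> V'))
        (\<lambda>p. \<psi>' (f p) (the_inv_into (fibre E (f p)) (\<phi>' (f p)) x))"
      by (rule smooth_preimage[OF open_Int[OF triv_props(1)[OF *(1)] triv_props(1)[OF *(2)]]
            transition_smooth[OF *(1,2)]])
    then show "smooth_fun_on B (U \<inter> V) (\<lambda>p. \<psi> p (the_inv_into (fibre E (f p)) (\<phi> p) x))"
      by (simp add: *(3-6))
  qed
qed

sublocale P: smooth_bundle B "pullback_bundle f E"
  by unfold_locales (rule pullback_vector_bundle)

lemma sections_pullback:
  assumes "s \<in> sections M E"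
  shows "(\<lambda>p. s (f p)) \<in> sections B (pullback_bundle f E)"
  using sections_fibre[OF assms] smooth_preimage[OF triv_props(1) sections_smooth[OF assms]]
  by (auto simp: sections_def pullback_trivs)

text \<open>Both factors have compact support, as required of the coefficients and the vector fields
  in \<open>pullback_vector_fields\<close>. Only real linear spans are formed: smooth coefficients
  are already absorbed into \<open>h\<close>.\<close>

definition generators :: "('b \<Rightarrow> 'v) set"
  where "generators = {\<lambda>p. h p *\<^sub>R c (f p) | h c. h \<in> Cinf_c B \<and> c \<in> sections_c M E}"

text \<open>Converts membership in the span into the indexed form used by
  \<open>pullback_vector_fields\<close>. The real scalar of each new term is moved into its
  coefficient function, and the term is placed at index \<open>n\<close>.\<close>

lemma span_generators_sum:
  assumes "a \<in> span generators"
  shows "\<exists>(n::nat) h c. (\<forall>i<n. h i \<in> Cinf_c B \<and> c i \<in> sections_c M E) \<and>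
    (\<forall>p. a p = (\<Sum>i<n. h i p *\<^sub>R c i (f p)))"
  using assms
proof (induction rule: span_induct_alt)
  case base
  show ?case by (intro exI[where x = 0]) simp
next
  case (step t g a)
  from step(1) obtain h0 c0 where g: "h0 \<in> Cinf_c B" "c0 \<in> sections_c M E"
    "g = (\<lambda>p. h0 p *\<^sub>R c0 (f p))"
    unfolding generators_def by blast
  obtain n :: nat and h c where a: "\<forall>i<n. h i \<in> Cinf_c B \<and> c i \<in> sections_c M E"
    "\<forall>p. a p = (\<Sum>i<n. h i p *\<^sub>R c i (f p))"
    using step(2) by blast
  have "smooth_fun_on B UNIV (\<lambda>p. t * h0 p)"
    using g(1)
    by (intro B.smooth_fun_on_bounded_linear[OF bounded_linear_mult_right open_UNIV])
      (simp add: Cinf_c_def Cinf_def)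
  moreover have "compactly_supported h0"
    using g(1) by (simp add: Cinf_c_def)
  then have "compactly_supported (\<lambda>p. t * h0 p)"
    by (metis compactly_supportedE compactly_supportedI mult_zero_right)
  ultimately have "(\<lambda>p. t * h0 p) \<in> Cinf_c B"
    by (simp add: Cinf_c_def Cinf_def)
  then show ?case
    using a g by (intro exI[where x = "Suc n"] exI[where x = "h(n := \<lambda>p. t * h0 p)"]
        exI[where x = "c(n := c0)"]) (auto simp: scaleR_fun_def less_Suc_eq)
qed

text \<open>A frame of \<open>E\<close> near \<open>f p\<close> pulls back to a frame near
  \<open>p\<close>, and the coefficients of a section in it become global after multiplication by
  \<open>\<eta>\<close>. The cutoff and the neighbourhood are chosen before the section, since the
  later induction applies the same cutoffs to changing sections.\<close>

lemma locally_generated: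
  "\<exists>N \<eta>. open N \<and> p \<in> N \<and> \<eta> \<in> Cinf B \<and> (\<forall>q\<in>N. \<eta> q = 1) \<and>
    (\<forall>a\<in>sections B (pullback_bundle f E). (\<lambda>q. \<eta> q *\<^sub>R a q) \<in> span generators)"
proof -
  obtain U \<phi> W C e where U: "(U, \<phi>) \<in> trivs E" and W: "open W" "f p \<in> W" "W \<subseteq> U"
    and C: "finite C" and e: "\<And>c. e c \<in> sections_c M E"
      "\<And>q v. q \<in> W \<Longrightarrow> v \<in> fibre E q \<Longrightarrow> v = (\<Sum>c\<in>C. (\<phi> q v \<bullet> c / (c \<bullet> c)) *\<^sub>R e c q)"
    by (rule local_generators[of "f p"]) (rule that)
  obtain \<eta> N K where \<eta>: "\<eta> \<in> Cinf B" "open N" "p \<in> N" "\<And>q. q \<in> N \<Longrightarrow> \<eta> q = 1"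
    "compact K" "K \<subseteq> f -` W" "\<And>q. q \<notin> K \<Longrightarrow> \<eta> q = 0"
    using B.bump_exists[OF open_preimage[OF W(1)], of p] W(2) by (metis vimageI2)
  have cl: "open (- K)"
    using \<eta>(5) by (simp add: compact_imp_closed open_Compl)
  have "(\<lambda>p. \<eta> p *\<^sub>R a p) \<in> span generators"
    if a: "a \<in> sections B (pullback_bundle f E)" for a
  proof -
    define h where "h c q = \<eta> q * (\<phi> (f q) (a q) \<bullet> c / (c \<bullet> c))" for c q
    have "smooth_fun_on B (f -` U) (\<lambda>q. \<phi> (f q) (a q))"
      using sections_smooth[OF a, of "f -` U" "\<lambda>p. \<phi> (f p)"] U by (auto simp: pullback_trivs)
    then have "smooth_fun_on B (f -` W) (\<lambda>q. \<phi> (f q) (a q))"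
      using W(3) by (elim B.smooth_fun_on_subset) auto
    moreover have "bounded_linear (\<lambda>y. y \<bullet> c / (c \<bullet> c))" for c :: 'r
      by (intro bounded_linear_compose[OF bounded_linear_divide] bounded_linear_inner_left)
    ultimately have "smooth_fun_on B (f -` W) (\<lambda>q. \<phi> (f q) (a q) \<bullet> c / (c \<bullet> c))" for c
      by (intro B.smooth_fun_on_bounded_linear[where L = "\<lambda>y. y \<bullet> c / (c \<bullet> c)"]
          open_preimage W)
    then have 1: "smooth_fun_on B (f -` W) (h c)" for c
      unfolding h_def using \<eta>(1)
      by (intro B.smooth_fun_on_bilinear[OF bounded_bilinear_mult] open_preimage W)
        (auto simp: Cinf_def intro: B.smooth_fun_on_subset)
    have 2: "smooth_fun_on B (- K) (h c)" for c
      by (rule B.smooth_fun_on_cong[OF cl B.smooth_fun_on_const[where c = 0]])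
        (simp add: h_def \<eta>(7))
    have "smooth_fun_on B (f -` W \<union> - K) (h c)" for c
      by (rule B.smooth_fun_on_UnI[OF open_preimage[OF W(1)] cl 1 2])
    moreover have "f -` W \<union> - K = UNIV"
      using \<eta>(6) by blast
    ultimately have h: "h c \<in> Cinf_c B" for c
      using compactly_supportedI[OF \<eta>(5), of "h c"] \<eta>(7) by (simp add: Cinf_c_def Cinf_def h_def)
    \<comment> \<open>On \<open>K\<close> the frame expansion applies, because \<open>f q\<close>
      lies in \<open>W\<close>; off \<open>K\<close> both sides vanish.\<close>
    have "\<eta> q *\<^sub>R a q = (\<Sum>c\<in>C. h c q *\<^sub>R e c (f q))" for q
    proof (cases "q \<in> K")
      case True
      then have "a q = (\<Sum>c\<in>C. (\<phi> (f q) (a q) \<bullet> c / (c \<bullet> c)) *\<^sub>R e c (f q))"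
        using \<eta>(6) sections_fibre[OF a] by (intro e(2)) auto
      then have "\<eta> q *\<^sub>R a q = \<eta> q *\<^sub>R (\<Sum>c\<in>C. (\<phi> (f q) (a q) \<bullet> c / (c \<bullet> c)) *\<^sub>R e c (f q))"
        by simp
      then show ?thesis
        by (simp add: scaleR_sum_right h_def)
    qed (simp add: \<eta>(7) h_def)
    then have "(\<lambda>q. \<eta> q *\<^sub>R a q) = (\<Sum>c\<in>C. (\<lambda>q. h c q *\<^sub>R e c (f q)))"
      by (simp add: fun_eq_iff sum_apply)
    moreover have "(\<lambda>q. h c q *\<^sub>R e c (f q)) \<in> span generators" for c
      using h e(1) by (intro span_base) (auto simp: generators_def)
    ultimately show ?thesis
      by (simp add: span_sum)
  qed
  with \<eta>(1-4) show ?thesis by blast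
qed

text \<open>In place of a partition of unity, the induction splits off \<open>\<eta> a\<close> with \<open>\<eta> = 1\<close> on one of the
  finitely many open sets, which leaves \<open>(1 - \<eta>) a\<close> vanishing there.\<close>

lemma compact_sections_generated:
  assumes "a \<in> sections_c B (pullback_bundle f E)"
  shows "a \<in> span generators"
proof -
  obtain N \<eta> where "\<forall>p. open (N p) \<and> p \<in> N p \<and> \<eta> p \<in> Cinf B \<and> (\<forall>q\<in>N p. \<eta> p q = 1) \<and>
      (\<forall>a\<in>sections B (pullback_bundle f E). (\<lambda>q. \<eta> p q *\<^sub>R a q) \<in> span generators)"
    using locally_generated by metis
  then have N: "open (N p)" "p \<in> N p" "\<eta> p \<in> Cinf B" "q \<in> N p \<Longrightarrow> \<eta> p q = 1"
    "a \<in> sections B (pullback_bundle f E) \<Longrightarrow> (\<lambda>q. \<eta> p q *\<^sub>R a q) \<in> span generators"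
    for p q a by blast+
  have a: "a \<in> sections B (pullback_bundle f E)" "compactly_supported a"
    using assms by (auto simp: sections_c_def)
  obtain K where K: "compact K" "\<And>q. q \<notin> K \<Longrightarrow> a q = 0"
    using compactly_supportedE[OF a(2)] by metis
  have "K \<subseteq> (\<Union>p\<in>UNIV. N p)"
    using N(2) by blast
  then obtain I where I: "finite I" "K \<subseteq> (\<Union>p\<in>I. N p)"
    by (rule compactE_image[OF K(1) N(1)])
  have "a \<in> span generators"
    if "finite I" "a \<in> sections B (pullback_bundle f E)" "\<And>q. q \<notin> (\<Union>p\<in>I. N p) \<Longrightarrow> a q = 0" for I a
    using that
  proof (induction I arbitrary: a rule: finite_induct)
    case empty
    then have "a = 0" by (simp add: fun_eq_iff)
    then show ?case by (simp only: span_zero)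
  next
    case (insert p I)
    let ?b = "\<lambda>q. (1 - \<eta> p q) *\<^sub>R a q"
    have "smooth_fun_on B UNIV (\<lambda>q. 1 + - \<eta> p q)"
      using N(3)[of p] by (intro B.smooth_fun_on_add B.smooth_fun_on_const
          B.smooth_fun_on_bounded_linear[OF bounded_linear_minus[OF bounded_linear_ident]])
        (auto simp: Cinf_def)
    then have "?b \<in> sections B (pullback_bundle f E)"
      by (intro P.sections_smult insert.prems) (simp add: Cinf_def)
    \<comment> \<open>Such a point either lies in \<open>N p\<close>, where the factor is 0, or lies
      outside all the sets, where \<open>a\<close> already vanishes.\<close>
    moreover have "?b q = 0" if "q \<notin> (\<Union>p\<in>I. N p)" for q
      using that insert.prems(2)[of q] N(4)[of q p] by auto
    ultimately have "?b \<in> span generators"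
      by (rule insert.IH)
    moreover have "a = (\<lambda>q. \<eta> p q *\<^sub>R a q) + ?b"
      by (simp add: fun_eq_iff algebra_simps)
    ultimately show ?case
      using span_add[OF N(5)[OF insert.prems(1), of p]] by metis
  qed
  from this[OF I(1) a(1)] show ?thesis
    using I(2) K(2) by blast
qed

end

text \<open>Pairing and the two projections preserve smoothness. What is asked of the
  trivialisations is that their domains are open and cover, which for the tangent bundle follows
  directly from the charts.\<close>

lemma sections_whitney_sum:
  fixes M :: "('m::{t2_space, second_countable_topology}, 'e::fin_dim_inner) atlas"
    and E :: "('m, 'v, 'r::real_normed_vector, 'x) vbundle_scheme"
    and F :: "('m, 'w, 's::real_normed_vector, 'y) vbundle_scheme"
  assumes M: "smooth_manifold M"
    and E: "\<And>p. \<exists>(U, \<phi>)\<in>trivs E. p \<in> U" "\<And>U \<phi>. (U, \<phi>) \<in> trivs E \<Longrightarrow> open U"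
    and F: "\<And>p. \<exists>(V, \<psi>)\<in>trivs F. p \<in> V" "\<And>V \<psi>. (V, \<psi>) \<in> trivs F \<Longrightarrow> open V"
  shows "s \<in> sections M (whitney_sum E F) \<longleftrightarrow>
    (\<lambda>p. fst (s p)) \<in> sections M E \<and> (\<lambda>p. snd (s p)) \<in> sections M F" (is "?L \<longleftrightarrow> ?R")
proof -
  interpret manifold M by (rule manifold.intro[OF M])
  have trivs: "(W, \<theta>) \<in> trivs (whitney_sum E F) \<longleftrightarrow> (\<exists>U \<phi> V \<psi>. (U, \<phi>) \<in> trivs E \<and>
      (V, \<psi>) \<in> trivs F \<and> W = U \<inter> V \<and> \<theta> = (\<lambda>p. map_prod (\<phi> p) (\<psi> p)))" for W \<theta>
    by (auto simp: whitney_sum_def)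
  have fib: "(\<forall>p. s p \<in> fibre (whitney_sum E F) p) \<longleftrightarrow>
      (\<forall>p. fst (s p) \<in> fibre E p) \<and> (\<forall>p. snd (s p) \<in> fibre F p)"
    by (auto simp: whitney_sum_def mem_Times_iff)
  show ?thesis
  proof
    assume L: ?L
    have 1: "smooth_fun_on M (U \<inter> V) (\<lambda>p. \<phi> p (fst (s p)))" "smooth_fun_on M (U \<inter> V) (\<lambda>p. \<psi> p (snd (s p)))"
      if UV: "(U, \<phi>) \<in> trivs E" "(V, \<psi>) \<in> trivs F" for U \<phi> V \<psi>
    proof -
      have "smooth_fun_on M (U \<inter> V) (\<lambda>p. map_prod (\<phi> p) (\<psi> p) (s p))"
        using UV by (intro sections_smooth[OF L]) (auto simp: trivs)
      from smooth_fun_on_bounded_linear[OF bounded_linear_fst open_Int[OF E(2) F(2)] this]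
        smooth_fun_on_bounded_linear[OF bounded_linear_snd open_Int[OF E(2) F(2)] this]
      show "smooth_fun_on M (U \<inter> V) (\<lambda>p. \<phi> p (fst (s p)))"
        "smooth_fun_on M (U \<inter> V) (\<lambda>p. \<psi> p (snd (s p)))"
        using UV by auto
    qed
    \<comment> \<open>Trivialisations of the sum live only on intersections, so smoothness on all of
      \<open>U\<close> is glued from the sets \<open>U \<inter> V\<close>.\<close>
    have "smooth_fun_on M U (\<lambda>p. \<phi> p (fst (s p)))" if U: "(U, \<phi>) \<in> trivs E" for U \<phi>
    proof -
      have "smooth_fun_on M (\<Union>((\<lambda>(V, \<psi>). U \<inter> V) ` trivs F)) (\<lambda>p. \<phi> p (fst (s p)))"
        by (intro smooth_fun_on_Union) (auto intro: 1(1)[OF U] E(2)[OF U] F(2))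
      moreover have "(\<Union>((\<lambda>(V, \<psi>). U \<inter> V) ` trivs F)) = U"
        using F(1) by fastforce
      ultimately show ?thesis by simp
    qed
    moreover have "smooth_fun_on M V (\<lambda>p. \<psi> p (snd (s p)))" if V: "(V, \<psi>) \<in> trivs F" for V \<psi>
    proof -
      have "smooth_fun_on M (\<Union>((\<lambda>(U, \<phi>). U \<inter> V) ` trivs E)) (\<lambda>p. \<psi> p (snd (s p)))"
        by (intro smooth_fun_on_Union) (auto intro: 1(2)[OF _ V] F(2)[OF V] E(2))
      moreover have "(\<Union>((\<lambda>(U, \<phi>). U \<inter> V) ` trivs E)) = V"
        using E(1) by fastforce
      ultimately show ?thesis by simp
    qed
    ultimately show ?R
      using L fib by (auto simp: sections_def)
  next
    assume R: ?R
    have "smooth_fun_on M (U \<inter> V) (\<lambda>p. map_prod (\<phi> p) (\<psi> p) (s p))"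
      if UV: "(U, \<phi>) \<in> trivs E" "(V, \<psi>) \<in> trivs F" for U \<phi> V \<psi>
    proof -
      have "smooth_fun_on M U (\<lambda>p. \<phi> p (fst (s p)))" "smooth_fun_on M V (\<lambda>p. \<psi> p (snd (s p)))"
        using R UV by (auto simp: sections_def)
      then have "smooth_fun_on M (U \<inter> V) (\<lambda>p. (\<phi> p (fst (s p)), \<psi> p (snd (s p))))"
        using E(2) F(2) UV
        by (intro smooth_fun_on_Pair) (auto intro: smooth_fun_on_subset)
      then show ?thesis
        by (simp add: map_prod_def case_prod_unfold)
    qed
    with R fib show ?L
      by (auto simp: sections_def trivs)
  qed
qed


section \<open>Pullback Lie algebroids\<close>

text \<open>The trivialisations are those of the Whitney sum, so the smoothness condition is the
  same and the smaller fibres contribute just the anchor equation.\<close>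

lemma sections_pullback_algebroid:
  "s \<in> sections B (pullback_algebroid B M f A) \<longleftrightarrow>
    s \<in> sections B (whitney_sum (pullback_bundle f A) (tangent_bundle B)) \<and>
    (\<forall>p. anchor A (f p) (fst (s p)) = pushforward M f (snd (s p)))"
  by (auto simp: sections_def pullback_algebroid_def pullback_fibre_def case_prod_unfold)

theorem proposition3p1:
  fixes B :: "('b::{t2_space, second_countable_topology}, 'd::fin_dim_inner) atlas"
    and M :: "('m::{t2_space, second_countable_topology}, 'e::fin_dim_inner) atlas"
    and f :: "'b \<Rightarrow> 'm"
    and A :: "('m, 'v::real_vector, 'r::fin_dim_inner) algebroid"
  assumes "smooth_manifold B"
    and "smooth_manifold M"
    and "smooth_map B M f"
    and "lie_algebroid M A"
    and "pullback_smooth B M f A"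
  shows "foliation B (pullback_algebroid B M f A) = pullback_vector_fields B M f (foliation M A)"
proof -
  have "vector_bundle M A"
    using assms(4) by (simp add: lie_algebroid_def)
  with assms(1-3) interpret bundle_pullback M A B f
    by unfold_locales
  have anchor: "fibre_linear (fibre A p) (anchor A p)" for p
    using assms(4) by (simp add: lie_algebroid_def bundle_morphism_def)
  have tangent: "\<exists>(V, \<psi>)\<in>trivs (tangent_bundle B). p \<in> V"
    "(V, \<psi>) \<in> trivs (tangent_bundle B) \<Longrightarrow> open V" for p V \<psi>
    using B.charts_cover[of p] by (auto simp: tangent_bundle_def B.chart_props)
  have sections_iff: "s \<in> sections B (pullback_algebroid B M f A) \<longleftrightarrow>
      (\<lambda>p. fst (s p)) \<in> sections B (pullback_bundle f A) \<and> (\<lambda>p. snd (s p)) \<in> vector_fields B \<and>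
      (\<forall>p. anchor A (f p) (fst (s p)) = pushforward M f (snd (s p)))" for s
    unfolding sections_pullback_algebroid
    by (subst sections_whitney_sum[OF assms(1) P.trivs_cover P.triv_props(1) tangent]) auto
  \<comment> \<open>The anchor is linear only on the fibres, so the values \<open>c i (f p)\<close>
    have to be placed in the fibre over \<open>f p\<close> first.\<close>
  have anchor_sum: "anchor A (f p) (\<Sum>i<n. h i p *\<^sub>R c i (f p)) =
      (\<Sum>i<n. h i p *\<^sub>R anchor A (f p) (c i (f p)))"
    if "\<And>i. i < n \<Longrightarrow> c i \<in> sections_c M A" for n :: nat and h and c p
    using that by (intro fibre_linear_sum[OF anchor fibre_subspace])
      (auto simp: sections_c_def intro: sections_fibre)
  show ?thesis
  proof (intro equalityI subsetI)
    fix X assume "X \<in> foliation B (pullback_algebroid B M f A)"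
    then obtain s where s: "s \<in> sections B (pullback_algebroid B M f A)" "compactly_supported s"
      and X: "X = (\<lambda>p. snd (s p))"
      by (auto simp: foliation_def sections_c_def pullback_algebroid_def)
    obtain K where K: "compact K" "\<And>q. q \<notin> K \<Longrightarrow> s q = 0"
      using compactly_supportedE[OF s(2)] by metis
    have "compactly_supported X" "compactly_supported (\<lambda>p. fst (s p))"
      using K(2) by (auto simp: X intro!: compactly_supportedI[OF K(1)])
    with s(1) have X_field: "X \<in> vector_fields_c B"
      and "(\<lambda>p. fst (s p)) \<in> sections_c B (pullback_bundle f A)"
      by (simp_all add: sections_iff sections_c_def X)
    then obtain n :: nat and h c where hc: "\<forall>i<n. h i \<in> Cinf_c B \<and> c i \<in> sections_c M A"
      "\<forall>p. fst (s p) = (\<Sum>i<n. h i p *\<^sub>R c i (f p))"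
      using span_generators_sum[OF compact_sections_generated] by blast
    \<comment> \<open>The anchor equation of the section \<open>s\<close>, applied to the
      decomposition of its first component, is exactly the equation defining the pullback of the
      foliation.\<close>
    have "pushforward M f (X p) = (\<Sum>i<n. h i p *\<^sub>R anchor A (f p) (c i (f p)))" for p
      using s(1) hc anchor_sum[of n c p h] by (simp add: sections_iff X)
    moreover have "(\<lambda>q. anchor A q (c i q)) \<in> foliation M A" if "i < n" for i
      using hc(1) that by (auto simp: foliation_def)
    ultimately show "X \<in> pullback_vector_fields B M f (foliation M A)"
      using X_field hc(1) unfolding pullback_vector_fields_def mem_Collect_eq
      by (intro conjI exI[where x = n] exI[where x = h]
          exI[where x = "\<lambda>i q. anchor A q (c i q)"]) auto
  next
    fix X assume "X \<in> pullback_vector_fields B M f (foliation M A)"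
    then obtain n :: nat and h Y where X: "X \<in> vector_fields_c B"
      and hY: "\<forall>i<n. h i \<in> Cinf_c B \<and> Y i \<in> foliation M A"
      and push: "\<forall>p. pushforward M f (X p) = (\<Sum>i<n. h i p *\<^sub>R Y i (f p))"
      unfolding pullback_vector_fields_def by blast
    have "\<forall>i. \<exists>c. i < n \<longrightarrow> c \<in> sections_c M A \<and> Y i = (\<lambda>p. anchor A p (c p))"
      using hY by (auto simp: foliation_def)
    then obtain c where c: "\<And>i. i < n \<Longrightarrow> c i \<in> sections_c M A"
      "\<And>i. i < n \<Longrightarrow> Y i = (\<lambda>p. anchor A p (c i p))"
      by metis
    \<comment> \<open>Lifting each \<open>Y i\<close> to a section \<open>c i\<close> of
      \<open>A\<close> turns the given expression for the pushforward of \<open>X\<close> into a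
      first component that satisfies the anchor equation.\<close>
    define a where "a p = (\<Sum>i<n. h i p *\<^sub>R c i (f p))" for p
    have summand: "(\<lambda>p. h i p *\<^sub>R c i (f p)) \<in> sections B (pullback_bundle f A)" if "i < n" for i
      using hY c(1)[OF that] that
      by (intro P.sections_smult sections_pullback) (auto simp: Cinf_c_def sections_c_def)
    have "a = (\<Sum>i<n. (\<lambda>p. h i p *\<^sub>R c i (f p)))"
      by (simp add: fun_eq_iff a_def sum_apply)
    also have "\<dots> \<in> sections B (pullback_bundle f A)"
      using summand by (intro subspace_sum P.subspace_sections) auto
    finally have a: "a \<in> sections B (pullback_bundle f A)" .
    have "\<forall>i. \<exists>K. i < n \<longrightarrow> compact K \<and> (\<forall>q. q \<notin> K \<longrightarrow> h i q = 0)"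
      using hY unfolding Cinf_c_def by (metis (no_types, lifting) compactly_supportedE mem_Collect_eq)
    then obtain K where K: "\<And>i. i < n \<Longrightarrow> compact (K i)" "\<And>i q. i < n \<Longrightarrow> q \<notin> K i \<Longrightarrow> h i q = 0"
      by metis
    have "compactly_supported X"
      using X by (simp add: sections_c_def)
    then obtain L where L: "compact L" "\<And>q. q \<notin> L \<Longrightarrow> X q = 0"
      by (rule compactly_supportedE) (rule that)
    \<comment> \<open>The compact support of \<open>c i\<close> does not bound that of its pullback
      along \<open>f\<close>; the supports of the coefficients \<open>h i\<close> do, together with
      that of \<open>X\<close>.\<close>
    have "compactly_supported (\<lambda>p. (a p, X p))"
    proof (rule compactly_supportedI)
      show "compact (L \<union> (\<Union>i<n. K i))"
        using L(1) K(1) by (intro compact_Un compact_UN) auto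
      show "(a q, X q) = 0" if "q \<notin> L \<union> (\<Union>i<n. K i)" for q
        using that L(2) K(2) by (auto simp: a_def zero_prod_def intro!: sum.neutral)
    qed
    moreover have "anchor A (f p) (a p) = pushforward M f (X p)" for p
      using anchor_sum[of n c p h] c push by (simp add: a_def)
    ultimately have "(\<lambda>p. (a p, X p)) \<in> sections_c B (pullback_algebroid B M f A)"
      using a X by (simp add: sections_c_def sections_iff)
    then show "X \<in> foliation B (pullback_algebroid B M f A)"
      unfolding foliation_def
      by (auto simp: pullback_algebroid_def intro!: exI[where x = "\<lambda>p. (a p, X p)"])
  qed
qed

end
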